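(* Let $G$ be a directed cactus forest. Then an optimal acyclic coloring of $G$ and the dichromatic number $\vec{\chi}(G)$ can be computed in linear time.
   Context: A directed cactus forest is a digraph in which any two directed cycles have at most one common vertex. For a digraph $G=(V,E)$, an acyclic $r$-coloring is a map $c:V\to\{1,\dots,r\}$ such that every color class induces a subdigraph with no directed cycle; $\vec{\chi}(G)$ is the least $r$ admitting an acyclic $r$-coloring, and an optimal acyclic coloring is an acyclic $\vec{\chi}(G)$-coloring. *)

theory Defs
  imports "Graph_Theory.Graph_Theory"
begin

section \<open>Directed cactus forests and acyclic colorings\<close>

text \<open>
  A library cycle is a non-empty closed arc list whose start vertex is arbitrary, so the rotations
  of one directed cycle are different lists. As subdigraphs, two cycles are equal iff their
  arc sets are; the vertices of a cycle are the tails of its arcs. Cycles of length two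
  (pairs of antiparallel arcs) are directed cycles.
\<close>

definition directed_cactus_forest :: "('a, 'b) pre_digraph \<Rightarrow> bool" where
  "directed_cactus_forest G \<longleftrightarrow> digraph G \<and>
     (\<forall>p q. pre_digraph.cycle G p \<and> pre_digraph.cycle G q \<and> set p \<noteq> set q \<longrightarrow>
        card (tail G ` set p \<inter> tail G ` set q) \<le> 1)"

definition acyclic_coloring :: "('a, 'b) pre_digraph \<Rightarrow> nat \<Rightarrow> ('a \<Rightarrow> nat) \<Rightarrow> bool" where
  "acyclic_coloring G r c \<longleftrightarrow> c ` verts G \<subseteq> {1..r} \<and>
     (\<forall>i\<in>{1..r}. \<nexists>p. pre_digraph.cycle (G \<restriction> {v \<in> verts G. c v = i}) p)"

definition dichromatic_number :: "('a, 'b) pre_digraph \<Rightarrow> nat" where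
  "dichromatic_number G = (LEAST r. \<exists>c. acyclic_coloring G r c)"

definition optimal_acyclic_coloring :: "('a, 'b) pre_digraph \<Rightarrow> ('a \<Rightarrow> nat) \<Rightarrow> bool" where
  "optimal_acyclic_coloring G c \<longleftrightarrow> acyclic_coloring G (dichromatic_number G) c"


section \<open>A random access machine\<close>

text \<open>
  Running time is measured on a unit-cost word RAM with structured control flow. A state consists of
  registers, which a program addresses directly, and of a memory, which it accesses only
  indirectly through \<open>Load\<close> and \<open>Store\<close>. The only arithmetic is addition and truncated subtraction.
\<close>

datatype com =
    Skip
  | Const nat nat               (* R[a] := k *)
  | Add nat nat nat             (* R[a] := R[b] + R[c] *)
  | Sub nat nat nat             (* R[a] := R[b] - R[c], truncated at 0 *)
  | Load nat nat                (* R[a] := M[R[b]] *)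
  | Store nat nat               (* M[R[a]] := R[b] *)
  | Seq com com
  | IfLess nat nat com com      (* branch on R[a] < R[b] *)
  | WhileLess nat nat com       (* iterate while R[a] < R[b] *)

type_synonym state = "(nat \<Rightarrow> nat) \<times> (nat \<Rightarrow> nat)"

text \<open>
  \<open>exec W P s t s'\<close>: program \<open>P\<close>, started in state \<open>s\<close>, halts in state \<open>s'\<close> after \<open>t\<close> steps.
  Every instruction and every evaluation of a test takes one step. \<open>W\<close> is the largest number that
  fits into a machine word: an instruction that would produce a larger number has no
  transition. Addresses are register contents, so if all words of the input are at most \<open>W\<close>,
  then all words and addresses that occur in the run are at most \<open>W\<close>.
\<close>

inductive exec :: "nat \<Rightarrow> com \<Rightarrow> state \<Rightarrow> nat \<Rightarrow> state \<Rightarrow> bool" for W :: nat where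
  Skip: "exec W Skip (R, M) 1 (R, M)"
| Const: "k \<le> W \<Longrightarrow> exec W (Const a k) (R, M) 1 (R(a := k), M)"
| Add: "R b + R c \<le> W \<Longrightarrow> exec W (Add a b c) (R, M) 1 (R(a := R b + R c), M)"
| Sub: "exec W (Sub a b c) (R, M) 1 (R(a := R b - R c), M)"
| Load: "exec W (Load a b) (R, M) 1 (R(a := M (R b)), M)"
| Store: "exec W (Store a b) (R, M) 1 (R, M(R a := R b))"
| Seq: "exec W P s t s' \<Longrightarrow> exec W Q s' t' s'' \<Longrightarrow> exec W (Seq P Q) s (t + t') s''"
| IfTrue: "R a < R b \<Longrightarrow> exec W P (R, M) t s' \<Longrightarrow> exec W (IfLess a b P Q) (R, M) (1 + t) s'"
| IfFalse: "\<not> R a < R b \<Longrightarrow> exec W Q (R, M) t s' \<Longrightarrow> exec W (IfLess a b P Q) (R, M) (1 + t) s'"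
| WhileTrue: "R a < R b \<Longrightarrow> exec W P (R, M) t s' \<Longrightarrow> exec W (WhileLess a b P) s' t' s'' \<Longrightarrow>
    exec W (WhileLess a b P) (R, M) (1 + t + t') s''"
| WhileFalse: "\<not> R a < R b \<Longrightarrow> exec W (WhileLess a b P) (R, M) 1 (R, M)"

text \<open>The input is in memory from address 0 on; all other cells and all registers are 0.\<close>

definition initial_state :: "nat list \<Rightarrow> state" where
  "initial_state xs = (\<lambda>_. 0, \<lambda>i. if i < length xs then xs ! i else 0)"

text \<open>
  A digraph with vertices \<open>0, \<dots>, n - 1\<close> is given by \<open>n\<close>, the number of arcs, and the arcs
  as (tail, head) pairs in arbitrary order.
\<close>

definition arc_list_of :: "nat pair_pre_digraph \<Rightarrow> (nat \<times> nat) list \<Rightarrow> bool" where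
  "arc_list_of G es \<longleftrightarrow> distinct es \<and> set es = parcs G"

definition encode :: "nat \<Rightarrow> (nat \<times> nat) list \<Rightarrow> nat list" where
  "encode n es = n # length es # concat (map (\<lambda>(u, v). [u, v]) es)"

inductive_cases exec_cases:
  "exec W Skip s t s'"
  "exec W (Const a k) s t s'"
  "exec W (Add a b c) s t s'"
  "exec W (Sub a b c) s t s'"
  "exec W (Load a b) s t s'"
  "exec W (Store a b) s t s'"
  "exec W (Seq P Q) s t s'"
  "exec W (IfLess a b P Q) s t s'"
  "exec W (WhileLess a b P) s t s'"

lemma exec_deterministic:
  "exec W P s t s' \<Longrightarrow> exec W P s u s'' \<Longrightarrow> u = t \<and> s'' = s'"
proof (induction arbitrary: u s'' rule: exec.induct)
  case (Seq P s t s1 Q t' s2)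
  from Seq.prems obtain v v' r where
    "u = v + v'" and 1: "exec W P s v r" and 2: "exec W Q r v' s''"
    by (rule exec_cases(7))
  with Seq.IH(1)[OF 1] Seq.IH(2)[of v' s''] show ?case by simp
next
  case (IfTrue R a b P M t s' Q)
  from IfTrue.prems IfTrue.hyps(1) obtain v where "u = Suc v" and 1: "exec W P (R, M) v s''"
    by (auto elim: exec_cases(8))
  with IfTrue.IH[OF 1] show ?case by simp
next
  case (IfFalse R a b Q M t s' P)
  from IfFalse.prems IfFalse.hyps(1) obtain v where "u = Suc v" and 1: "exec W Q (R, M) v s''"
    by (auto elim: exec_cases(8))
  with IfFalse.IH[OF 1] show ?case by simp
next
  case (WhileTrue R a b P M t s1 t' s2)
  from WhileTrue.prems WhileTrue.hyps(1) obtain v v' r where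
    "u = Suc (v + v')" and 1: "exec W P (R, M) v r" and 2: "exec W (WhileLess a b P) r v' s''"
    by (auto elim: exec_cases(9))
  with WhileTrue.IH(1)[OF 1] WhileTrue.IH(2)[of v' s''] show ?case by simp
next
  case (WhileFalse R a b P M)
  from WhileFalse.prems show ?case by (rule exec_cases(9)) (use WhileFalse.hyps in auto)
next
  case Skip
  from Skip.prems show ?case by (rule exec_cases(1)) simp
next
  case Const
  from Const.prems show ?case by (rule exec_cases(2)) simp
next
  case Add
  from Add.prems show ?case by (rule exec_cases(3)) simp
next
  case Sub
  from Sub.prems show ?case by (rule exec_cases(4)) simp
next
  case Load
  from Load.prems show ?case by (rule exec_cases(5)) simp
next
  case Store
  from Store.prems show ?case by (rule exec_cases(6)) simp
qed

end

theory Submission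
  imports Defs
begin

text \<open>
  The end of a longest path of a digraph has all its out-neighbors on the path. In a directed cactus
  forest it therefore has out-degree at most 1: two out-neighbors would close two cycles that share
  the last arc of the path. Since this also holds for induced subdigraphs, all vertices can be
  removed one by one such that each has at most one out-neighbor among those not removed before.
  If the colors 1 and 2 are assigned in the reverse order and each vertex avoids the color of that
  out-neighbor, then the first removed vertex of any cycle differs from its successor. The digraph
  is acyclic iff already the removal of vertices of out-degree 0 exhausts it. With remaining
  out-degrees, lists of ingoing arcs and a queue of removable vertices, both removals together take
  linear time.
\<close>

section \<open>Cycles in digraphs and directed cactus forests\<close>

text \<open>Both removals are one process with a threshold \<open>k\<close>, which starts at 0 and
  is raised by 1 whenever the queue runs dry while vertices are left. A vertex is queued once fewer
  than \<open>k\<close> untraversed arcs leave it. Vertices queued under a smaller threshold keep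
  their positions, since they satisfy the stronger bound. Running dry at \<open>k\<close> with
  vertices left refutes every coloring with \<open>k\<close> colors: for \<open>k = 0\<close>
  because a vertex exists, for \<open>k = 1\<close> because the remaining vertices contain a cycle;
  for \<open>k = 2\<close> it cannot happen. So the final \<open>k\<close> is the dichromatic
  number, with 0 for the empty digraph. Only lists of ingoing arcs are stored, so a vertex that is
  to be colored cannot look up its out-neighbor. Instead, a vertex that gets its final color hands
  the complementary one back along its ingoing arcs as a tentative color. The same lists thus serve
  removal and coloring.\<close>

lemma (in wf_digraph) apath_end_in_verts:
  assumes "apath u p v"
  shows "v \<in> set (awalk_verts u p)"
  using assms last_in_set[OF awalk_verts_non_Nil, of u p] awlast_of_awalk[of u p v]
  by (auto simp: apath_def NOMATCH_def)

text \<open>The vertices of a path are the tails of its arcs followed by its end, and they are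
  distinct. This will tell apart two cycles that are closed at the same end by different
  arcs.\<close>

lemma (in wf_digraph) apath_tail_neq_end:
  assumes "apath u p v" "e \<in> set p"
  shows "tail G e \<noteq> v"
proof -
  have p: "p \<noteq> []" using assms(2) by auto
  then have vs: "awalk_verts u p = map (tail G) p @ [head G (last p)]"
    by (simp add: awalk_verts_conv)
  moreover have "last (awalk_verts u p) = v" using assms(1) by (auto simp: apath_def)
  ultimately have "head G (last p) = v" by simp
  then have "v \<notin> tail G ` set p" using assms(1) vs by (auto simp: apath_def)
  then show ?thesis using assms(2) by blast
qed

text \<open>The path lives in \<open>G\<close> and only its vertices are confined to
  \<open>S\<close>. Thus the induced subdigraph never has to be formed and the cactus property need
  not be passed on to it.\<close>

lemma (in digraph) ex_saturated_apath:
  assumes "S \<subseteq> verts G" "S \<noteq> {}"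
  obtains u p v where "apath u p v" "set (awalk_verts u p) \<subseteq> S"
    "\<And>e. e \<in> arcs G \<Longrightarrow> tail G e = v \<Longrightarrow> head G e \<in> S \<Longrightarrow> head G e \<in> set (awalk_verts u p)"
proof -
  define P where "P = (\<lambda>p. \<exists>u v. apath u p v \<and> set (awalk_verts u p) \<subseteq> S)"
  have bound: "length p < card S + 1" if "P p" for p
  proof -
    from that obtain u v where "distinct (awalk_verts u p)" "set (awalk_verts u p) \<subseteq> S"
      unfolding P_def apath_def by blast
    then have "length (awalk_verts u p) \<le> card S"
      by (metis assms(1) card_mono distinct_card finite_subset finite_verts)
    then show ?thesis by (simp add: length_awalk_verts)
  qed
  obtain s where "s \<in> S" using assms by blast
  then have "P []" unfolding P_def using assms(1) by (intro exI[of _ s]) (auto simp: apath_Nil_iff)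
  then obtain p where p: "P p" and max: "\<And>q. P q \<Longrightarrow> length q \<le> length p"
    using ex_has_greatest_nat[of P "[]" length "card S + 1"] bound by (metis less_imp_le)
  then obtain u v where uv: "apath u p v" "set (awalk_verts u p) \<subseteq> S" unfolding P_def by blast
  show thesis
  proof (rule that[OF uv], rule ccontr)
    fix e assume e: "e \<in> arcs G" "tail G e = v" "head G e \<in> S" "head G e \<notin> set (awalk_verts u p)"
    have v: "awlast u p = v" using uv(1) by (auto simp: apath_def)
    have "v \<in> set (awalk_verts u p)" using apath_end_in_verts[OF uv(1)] .
    then have "apath v [e] (head G e)"
      using e by (auto simp: apath_def awalk_simps)
    then have "apath u (p @ [e]) (head G e)"
      using uv e v by (simp add: apath_append_iff)
    moreover have "set (awalk_verts u (p @ [e])) \<subseteq> S"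
      using uv e v \<open>v \<in> set (awalk_verts u p)\<close> by (auto simp: awalk_verts_conv split: if_splits)
    ultimately have "P (p @ [e])" unfolding P_def by blast
    then show False using max by fastforce
  qed
qed

text \<open>The suffix of the path that starts at the head of \<open>e\<close> is closed by
  \<open>e\<close>. The splitting of \<open>p\<close> belongs to the conclusion because two nonempty
  suffixes of one path end with the same arc.\<close>

lemma (in wf_digraph) apath_closing_arc:
  assumes p: "apath u p v" and e: "e \<in> arcs G" "tail G e = v" "head G e \<in> set (awalk_verts u p)"
  obtains q r where "p = q @ r" "apath (head G e) r v" "cycle (r @ [e])"
proof -
  from p e(3) obtain q r where qr: "p = q @ r" "awalk u q (head G e)" "awalk (head G e) r v"
    using awalk_decomp unfolding apath_def by blast
  then have r: "apath (head G e) r v"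
    using p by (metis apath_append_iff awlast_of_awalk NOMATCH_def)
  have c: "awalk (head G e) (r @ [e]) (head G e)"
    using qr e by (auto simp: awalk_simps)
  have d: "distinct (awalk_verts (head G e) r)" using r by (simp add: apath_def)
  have "awalk_verts (head G e) (r @ [e]) = map (tail G) r @ [v, head G e]"
    using e by (simp add: awalk_verts_conv)
  moreover have "awalk_verts (head G e) r = map (tail G) r @ [v]"
    using r by (auto simp: awalk_verts_conv apath_def awalk_def cas_append_iff[symmetric]
        dest: awlast_if_cas split: if_splits)
  ultimately have "awalk_verts (head G e) (r @ [e]) = awalk_verts (head G e) r @ [head G e]" by simp
  moreover have "hd (awalk_verts (head G e) r) = head G e" using r by (auto simp: apath_def)
  ultimately have "distinct (tl (awalk_verts (head G e) (r @ [e])))"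
    using d by (cases "awalk_verts (head G e) r") auto
  then have "cycle (r @ [e])" unfolding cycle_def using c by blast
  then show thesis using that qr(1) r by blast
qed

lemma (in digraph) ex_cycle_in:
  assumes S: "S \<subseteq> verts G" "S \<noteq> {}"
    and out: "\<And>v. v \<in> S \<Longrightarrow> \<exists>e\<in>arcs G. tail G e = v \<and> head G e \<in> S"
  shows "\<exists>p. cycle p"
proof -
  obtain u p v where p: "apath u p v" "set (awalk_verts u p) \<subseteq> S"
    and sat: "\<And>e. e \<in> arcs G \<Longrightarrow> tail G e = v \<Longrightarrow> head G e \<in> S \<Longrightarrow> head G e \<in> set (awalk_verts u p)"
    using ex_saturated_apath[OF S] by metis
  have "v \<in> set (awalk_verts u p)"
    using apath_end_in_verts[OF p(1)] .
  with out p(2) obtain e where e: "e \<in> arcs G" "tail G e = v" "head G e \<in> S" by blast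
  show ?thesis using apath_closing_arc[OF p(1) e(1,2) sat[OF e]] by blast
qed

lemma directed_cactus_forest_ex_outdegree_le_1:
  assumes G: "directed_cactus_forest G" and S: "S \<subseteq> verts G" "S \<noteq> {}"
  shows "\<exists>v\<in>S. card {e \<in> arcs G. tail G e = v \<and> head G e \<in> S} \<le> 1"
proof -
  interpret digraph G using G by (simp add: directed_cactus_forest_def)
  obtain u p v where p: "apath u p v" "set (awalk_verts u p) \<subseteq> S"
    and sat: "\<And>e. e \<in> arcs G \<Longrightarrow> tail G e = v \<Longrightarrow> head G e \<in> S \<Longrightarrow> head G e \<in> set (awalk_verts u p)"
    using ex_saturated_apath[OF S] by metis
  have v: "v \<in> S"
    using apath_end_in_verts[OF p(1)] p(2) by blast
  have "e = e'" if e: "e \<in> arcs G" "tail G e = v" "head G e \<in> S"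
    and e': "e' \<in> arcs G" "tail G e' = v" "head G e' \<in> S" for e e'
  proof (rule ccontr)
    assume ne: "e \<noteq> e'"
    obtain q r where r: "p = q @ r" "apath (head G e) r v" "cycle (r @ [e])"
      using apath_closing_arc[OF p(1) e(1,2) sat[OF e]] .
    obtain q' r' where r': "p = q' @ r'" "apath (head G e') r' v" "cycle (r' @ [e'])"
      using apath_closing_arc[OF p(1) e'(1,2) sat[OF e']] .
    \<comment> \<open>Without loops both heads differ from \<open>v\<close>, so both suffixes
      contain the last arc of \<open>p\<close>.\<close>
    have "r \<noteq> []" "r' \<noteq> []" using r(2) r'(2) e(1,2) e'(1,2) no_loops by (metis apath_Nil_iff)+
    then have last: "last r = last p" "last r' = last p" using r(1) r'(1) by (metis last_appendR)+
    \<comment> \<open>No arc of \<open>r'\<close> has tail \<open>v\<close>, so \<open>e\<close>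
      distinguishes the arc sets of the two cycles, as the cactus property demands.\<close>
    have "e \<notin> set (r' @ [e'])" using ne apath_tail_neq_end[OF r'(2)] e(2) by auto
    then have "set (r @ [e]) \<noteq> set (r' @ [e'])" by auto
    then have "card (tail G ` set (r @ [e]) \<inter> tail G ` set (r' @ [e'])) \<le> 1"
      using G r(3) r'(3) unfolding directed_cactus_forest_def by blast
    moreover have "{v, tail G (last p)} \<subseteq> tail G ` set (r @ [e]) \<inter> tail G ` set (r' @ [e'])"
      using e e' last \<open>r \<noteq> []\<close> \<open>r' \<noteq> []\<close> last_in_set by (force simp: image_iff)
    moreover have "card {v, tail G (last p)} = 2"
      using apath_tail_neq_end[OF r(2), of "last r"] last(1) last_in_set[OF \<open>r \<noteq> []\<close>]
        by (auto simp: card_insert_if)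
    ultimately show False
      using card_mono[of "tail G ` set (r @ [e]) \<inter> tail G ` set (r' @ [e'])" "{v, tail G (last p)}"]
      by simp
  qed
  then have "card {e \<in> arcs G. tail G e = v \<and> head G e \<in> S} \<le> 1"
    by (auto simp: card_le_Suc0_iff_eq)
  with v show ?thesis by blast
qed

lemma (in pre_digraph) cas_head_in_tails:
  assumes "cas u p v" "e \<in> set p"
  shows "head G e \<in> insert v (tail G ` set p)"
  using assms
proof (induct p arbitrary: u)
  case (Cons a p)
  then show ?case by (cases p) auto
qed simp

text \<open>Stated for a bare \<open>pre_digraph\<close>, so that it applies to the subdigraph
  induced by a color class without further proof obligations.\<close>

lemma (in pre_digraph) cycle_head_in_tails:
  assumes "cycle p" "e \<in> set p"
  shows "head G e \<in> tail G ` set p"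
proof -
  obtain u where u: "cas u p u" "p \<noteq> []" using assms(1) by (auto simp: cycle_def awalk_def)
  then have "u \<in> tail G ` set p" by (cases p) auto
  then show ?thesis using cas_head_in_tails[OF u(1) assms(2)] by auto
qed

lemma dichromatic_number_eqI:
  assumes "acyclic_coloring H k c" "\<And>r c. r < k \<Longrightarrow> \<not> acyclic_coloring H r c"
  shows "dichromatic_number H = k"
  unfolding dichromatic_number_def
  by (rule Least_equality) (use assms in \<open>auto simp: not_less[symmetric]\<close>)

section \<open>Weakest preconditions with time credits\<close>

text \<open>The existence of a run covers termination and the word bound at once. Credits are
  integers, so subtraction never truncates and a final \<open>0 \<le> T\<close> bounds the number of
  steps by the initial credit.\<close>

definition wp :: "nat \<Rightarrow> com \<Rightarrow> (state \<Rightarrow> int \<Rightarrow> bool) \<Rightarrow> state \<Rightarrow> int \<Rightarrow> bool" where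
  "wp W P Q s T \<longleftrightarrow> (\<exists>t s'. exec W P s t s' \<and> Q s' (T - int t))"

lemma wp_Skip: "wp W Skip Q (R, M) T \<longleftrightarrow> Q (R, M) (T - 1)"
  unfolding wp_def by (force intro: exec.Skip elim: exec_cases(1))

lemma wp_Const: "wp W (Const a k) Q (R, M) T \<longleftrightarrow> k \<le> W \<and> Q (R(a := k), M) (T - 1)"
  unfolding wp_def by (force intro: exec.Const elim: exec_cases(2))

lemma wp_Add: "wp W (Add a b c) Q (R, M) T \<longleftrightarrow> R b + R c \<le> W \<and> Q (R(a := R b + R c), M) (T - 1)"
  unfolding wp_def by (force intro: exec.Add elim: exec_cases(3))

lemma wp_Sub: "wp W (Sub a b c) Q (R, M) T \<longleftrightarrow> Q (R(a := R b - R c), M) (T - 1)"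
  unfolding wp_def by (force intro: exec.Sub elim: exec_cases(4))

lemma wp_Load: "wp W (Load a b) Q (R, M) T \<longleftrightarrow> Q (R(a := M (R b)), M) (T - 1)"
  unfolding wp_def by (force intro: exec.Load elim: exec_cases(5))

lemma wp_Store: "wp W (Store a b) Q (R, M) T \<longleftrightarrow> Q (R, M(R a := R b)) (T - 1)"
  unfolding wp_def by (force intro: exec.Store elim: exec_cases(6))

lemma wp_Seq: "wp W (Seq P P') Q s T \<longleftrightarrow> wp W P (wp W P' Q) s T"
proof
  assume "wp W (Seq P P') Q s T"
  then show "wp W P (wp W P' Q) s T"
    unfolding wp_def by (fastforce elim: exec_cases(7) simp: algebra_simps)
next
  assume "wp W P (wp W P' Q) s T"
  then obtain t s' t' s'' where e: "exec W P s t s'" "exec W P' s' t' s''"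
    "Q s'' (T - int t - int t')"
    unfolding wp_def by blast
  then show "wp W (Seq P P') Q s T"
    unfolding wp_def by (intro exI[of _ "t + t'"] exI[of _ s''])
      (simp add: exec.Seq[OF e(1,2)] diff_diff_eq)
qed

lemma wp_IfLess: "wp W (IfLess a b P P') Q (R, M) T \<longleftrightarrow>
    wp W (if R a < R b then P else P') Q (R, M) (T - 1)"
proof
  assume "wp W (IfLess a b P P') Q (R, M) T"
  then show "wp W (if R a < R b then P else P') Q (R, M) (T - 1)"
    unfolding wp_def by (fastforce elim!: exec_cases(8) simp: diff_diff_eq)
next
  assume "wp W (if R a < R b then P else P') Q (R, M) (T - 1)"
  then obtain t s' where e: "exec W (if R a < R b then P else P') (R, M) t s'"
    "Q s' (T - 1 - int t)"
    unfolding wp_def by blast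
  then have "exec W (IfLess a b P P') (R, M) (1 + t) s'"
    using exec.IfTrue[of R a b W P M t s' P'] exec.IfFalse[of R a b W P' M t s' P]
      by (cases "R a < R b") auto
  then show "wp W (IfLess a b P P') Q (R, M) T"
    unfolding wp_def using e(2) by (intro exI[of _ "1 + t"] exI[of _ s']) (simp add: diff_diff_eq)
qed

lemmas wp_simps = wp_Skip wp_Const wp_Add wp_Sub wp_Load wp_Store wp_Seq wp_IfLess

text \<open>No separate variant is needed: the remaining time is non-negative and decreases.\<close>

lemma wp_While:
  assumes "I s T"
    and nonneg: "\<And>s T. I s T \<Longrightarrow> 0 \<le> T"
    and body: "\<And>R M T. I (R, M) T \<Longrightarrow> R a < R b \<Longrightarrow> wp W P I (R, M) (T - 1)"
    and exit: "\<And>R M T. I (R, M) T \<Longrightarrow> \<not> R a < R b \<Longrightarrow> Q (R, M) (T - 1)"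
  shows "wp W (WhileLess a b P) Q s T"
  using assms(1)
proof (induction "nat T" arbitrary: s T rule: less_induct)
  case less
  obtain R M where s: "s = (R, M)" by (cases s)
  show ?case
  proof (cases "R a < R b")
    case True
    obtain t s' where e: "exec W P (R, M) t s'" "I s' (T - 1 - int t)"
      using body[of R M T] less.prems True unfolding s wp_def by blast
    moreover have "nat (T - 1 - int t) < nat T" using nonneg[OF e(2)] by linarith
    ultimately have "wp W (WhileLess a b P) Q s' (T - 1 - int t)" using less.hyps by blast
    then obtain t' s'' where e': "exec W (WhileLess a b P) s' t' s''"
      "Q s'' (T - 1 - int t - int t')"
      unfolding wp_def by blast
    have "exec W (WhileLess a b P) s (1 + t + t') s''"
      unfolding s using True e(1) e'(1) by (rule exec.WhileTrue)
    moreover have "T - int (1 + t + t') = T - 1 - int t - int t'" by simp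
    ultimately show ?thesis unfolding wp_def using e'(2) by metis
  next
    case False
    then have "exec W (WhileLess a b P) s 1 s" unfolding s by (rule exec.WhileFalse)
    then show ?thesis unfolding wp_def using exit[of R M T] less.prems False s
      by (metis of_nat_1)
  qed
qed

section \<open>Removal orders and colorings\<close>

locale arc_list =
  fixes n :: nat and es :: "(nat \<times> nat) list" and G :: "nat pair_pre_digraph"
  assumes cactus: "directed_cactus_forest (with_proj G)"
    and verts: "pverts G = {0..<n}"
    and arcs: "arc_list_of G es"
begin

sublocale digraph "with_proj G"
  using cactus by (simp add: directed_cactus_forest_def)

definition m :: nat where "m = length es"
definition src :: "nat \<Rightarrow> nat" where "src e = fst (es ! (e - 1))"
definition dst :: "nat \<Rightarrow> nat" where "dst e = snd (es ! (e - 1))"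

text \<open>Lets out-degrees be counted by arc numbers instead of arcs; injectivity rests on the
  distinctness of \<open>es\<close>.\<close>

lemma ends_bij: "bij_betw (\<lambda>e. (src e, dst e)) {1..m} (parcs G)"
proof -
  have "bij_betw (\<lambda>i. es ! i) {..<length es} (parcs G)"
    using arcs bij_betw_nth[of es "{..<length es}" "set es"] by (simp add: arc_list_of_def)
  moreover have "bij_betw (\<lambda>e. e - 1) {1..m} {..<length es}"
    by (rule bij_betwI[where g = Suc]) (auto simp: m_def)
  ultimately have "bij_betw ((\<lambda>i. es ! i) \<circ> (\<lambda>e. e - 1)) {1..m} (parcs G)"
    by (rule bij_betw_trans[rotated])
  then show ?thesis by (simp add: src_def dst_def o_def)
qed

lemma card_arcs: "card (parcs G) = m"
  using bij_betw_same_card[OF ends_bij] by simp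

lemma ends_in_parcs: "e \<in> {1..m} \<Longrightarrow> (src e, dst e) \<in> parcs G"
  using ends_bij by (auto dest: bij_betw_apply)

lemma ends_less [simp]:
  assumes "1 \<le> e" "e \<le> m"
  shows "src e < n" "dst e < n"
  using ends_in_parcs[of e] assms tail_in_verts[of "(src e, dst e)"] head_in_verts[of "(src e, dst e)"]
  by (auto simp: verts)

lemma src_neq_dst:
  assumes "1 \<le> e" "e \<le> m"
  shows "src e \<noteq> dst e"
  using ends_in_parcs[of e] assms no_loops[of "(src e, dst e)"] by auto

lemma card_out_arcs:
  "card {a \<in> parcs G. fst a = v \<and> snd a \<in> S} = card {e \<in> {1..m}. src e = v \<and> dst e \<in> S}"
proof -
  have "{a \<in> parcs G. fst a = v \<and> snd a \<in> S} =
      (\<lambda>e. (src e, dst e)) ` {e \<in> {1..m}. src e = v \<and> dst e \<in> S}"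
    unfolding bij_betw_imp_surj_on[OF ends_bij, symmetric] by auto
  moreover have "inj_on (\<lambda>e. (src e, dst e)) {e \<in> {1..m}. src e = v \<and> dst e \<in> S}"
    using bij_betw_imp_inj_on[OF ends_bij] by (rule inj_on_subset) auto
  ultimately show ?thesis by (simp only: card_image)
qed

definition into :: "nat list \<Rightarrow> nat set" where
  "into qs = {e \<in> {1..m}. dst e \<in> set qs}"

abbreviation pending :: "nat list \<Rightarrow> nat set" where
  "pending qs \<equiv> {1..m} - into qs"

text \<open>
  \<open>A\<close> contains the arcs that have not been traversed yet; \<open>d u\<close> is kept up to date only until \<open>u\<close>
  enters the queue \<open>qs\<close>. The threshold \<open>K\<close> depends on the vertex because it is raised vertex by
  vertex.
\<close>

definition peeling :: "(nat \<Rightarrow> nat) \<Rightarrow> nat set \<Rightarrow> nat list \<Rightarrow> (nat \<Rightarrow> nat) \<Rightarrow> bool" where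
  "peeling K A qs d \<longleftrightarrow> distinct qs \<and> set qs \<subseteq> {..<n} \<and> A \<subseteq> {1..m} \<and> {1..m} - A \<subseteq> into qs \<and>
     (\<forall>u<n. u \<in> set qs \<longleftrightarrow> d u < K u) \<and>
     (\<forall>u<n. u \<notin> set qs \<longrightarrow> d u = card {e \<in> A. src e = u}) \<and>
     (\<forall>j<length qs. card {e \<in> {1..m}. src e = qs ! j \<and> dst e \<notin> set (take j qs)} < K (qs ! j))"

text \<open>This and the next two lemmas are the outcomes of raising the threshold at a vertex
  \<open>u\<close>: it was queued before, it still has too many arcs, or it becomes
  removable.\<close>

lemma peeling_raise:
  assumes "peeling K A qs d" "u \<in> set qs" "K u \<le> b"
  shows "peeling (K(u := b)) A qs d"
  using assms unfolding peeling_def by (fastforce intro: less_le_trans)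

lemma peeling_keep:
  assumes "peeling K A qs d" "u \<notin> set qs" "b \<le> d u"
  shows "peeling (K(u := b)) A qs d"
  using assms unfolding peeling_def by (auto dest: nth_mem)

text \<open>Arcs outside \<open>A\<close> have queued heads, so \<open>d u\<close> bounds the number
  of arcs from \<open>u\<close> to unqueued vertices. It may be larger, as arcs to queued but
  unprocessed vertices still count.\<close>

lemma peeling_push:
  assumes p: "peeling K A qs d" and u: "u < n" "u \<notin> set qs" "d u < b"
  shows "peeling (K(u := b)) A (qs @ [u]) d"
proof -
  have "finite A" using p finite_subset[of A "{1..m}"] by (auto simp: peeling_def)
  then have "card {e \<in> {1..m}. src e = u \<and> dst e \<notin> set qs} \<le> card {e \<in> A. src e = u}"
    using p by (intro card_mono) (auto simp: peeling_def into_def)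
  also have "\<dots> = d u" using p u by (simp add: peeling_def)
  finally have "card {e \<in> {1..m}. src e = u \<and> dst e \<notin> set qs} < b" using u(3) by simp
  then have "card {e \<in> {1..m}. src e = (qs @ [u]) ! j \<and>
    dst e \<notin> set (take j (qs @ [u]))} < (K(u := b)) ((qs @ [u]) ! j)"
    if "j < length (qs @ [u])" for j
    using p that u(2) unfolding peeling_def by (cases "j = length qs") (auto simp: nth_append)
  moreover have "{1..m} - A \<subseteq> into (qs @ [u])" using p by (auto simp: peeling_def into_def)
  moreover have "v \<in> set (qs @ [u]) \<longleftrightarrow> d v < (K(u := b)) v" if "v < n" for v
    using p that u(3) by (auto simp: peeling_def)
  moreover have "d v = card {e \<in> A. src e = v}" if "v < n" "v \<notin> set (qs @ [u])" for v
    using p that by (auto simp: peeling_def)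
  moreover have "distinct (qs @ [u])" "set (qs @ [u]) \<subseteq> {..<n}" "A \<subseteq> {1..m}"
    using p u by (auto simp: peeling_def)
  ultimately show ?thesis unfolding peeling_def by blast
qed

lemma peeling_arc_queued:
  assumes "peeling K A qs d" "e \<in> A" "dst e \<in> set qs" "src e \<in> set qs"
  shows "peeling K (A - {e}) qs d"
proof -
  have "{e' \<in> A - {e}. src e' = u} = {e' \<in> A. src e' = u}" if "u \<notin> set qs" for u
    using that assms(4) by auto
  then show ?thesis using assms unfolding peeling_def by (auto simp: into_def)
qed

text \<open>After the decrement the tail may fall below its threshold without being queued yet.
  Lowering its threshold to \<open>b\<close> keeps the invariant true in between.\<close>

lemma peeling_arc:
  assumes p: "peeling K A qs d" and e: "e \<in> A" "dst e \<in> set qs" "src e \<notin> set qs"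
    and b: "b \<le> d (src e) - 1"
  shows "peeling (K(src e := b)) (A - {e}) qs (d(src e := d (src e) - 1))"
proof -
  have "finite A" using p finite_subset[of A "{1..m}"] by (auto simp: peeling_def)
  have other: "{e' \<in> A - {e}. src e' = u} = {e' \<in> A. src e' = u}" if "u \<noteq> src e" for u
    using that by auto
  have "{e' \<in> A - {e}. src e' = src e} = {e' \<in> A. src e' = src e} - {e}" by auto
  then have own: "card {e' \<in> A - {e}. src e' = src e} = card {e' \<in> A. src e' = src e} - 1"
    using e(1) \<open>finite A\<close> by simp
  have q: "distinct qs" "set qs \<subseteq> {..<n}" "A \<subseteq> {1..m}" "{1..m} - A \<subseteq> into qs"
    and th: "\<And>u. u < n \<Longrightarrow> u \<in> set qs \<longleftrightarrow> d u < K u"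
    and deg: "\<And>u. u < n \<Longrightarrow> u \<notin> set qs \<Longrightarrow> d u = card {e \<in> A. src e = u}"
    and early: "\<And>j. j < length qs \<Longrightarrow>
      card {e \<in> {1..m}. src e = qs ! j \<and> dst e \<notin> set (take j qs)} < K (qs ! j)"
    using p unfolding peeling_def by blast+
  have "e \<in> into qs" using q(3) e by (auto simp: into_def)
  then have "{1..m} - (A - {e}) \<subseteq> into qs" using q(4) by blast
  moreover have "u \<in> set qs \<longleftrightarrow> (d(src e := d (src e) - 1)) u < (K(src e := b)) u" if "u < n" for u
    using th[OF that] e(3) b by auto
  moreover have "(d(src e := d (src e) - 1)) u = card {e' \<in> A - {e}. src e' = u}"
    if "u < n" "u \<notin> set qs" for u
    using deg[OF that] own other[of u] by (cases "u = src e") auto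
  moreover have "qs ! j \<noteq> src e" if "j < length qs" for j
    using that e(3) by (metis nth_mem)
  ultimately show ?thesis using q(1-3) early unfolding peeling_def by auto
qed

lemma peeling_arc_step:
  assumes p: "peeling (\<lambda>_. k) A qs d" and e: "e \<in> A" "dst e \<in> set qs" "\<not> d (src e) < k"
  defines "d' \<equiv> d(src e := d (src e) - 1)"
  shows "d' (src e) < k \<Longrightarrow> peeling (\<lambda>_. k) (A - {e}) (qs @ [src e]) d'"
    and "\<not> d' (src e) < k \<Longrightarrow> peeling (\<lambda>_. k) (A - {e}) qs d'"
proof -
  have "e \<in> {1..m}" using p e(1) by (auto simp: peeling_def)
  then have u: "src e < n" by simp
  then have nq: "src e \<notin> set qs" using p e(3) by (auto simp: peeling_def)
  show "peeling (\<lambda>_. k) (A - {e}) (qs @ [src e]) d'" if "d' (src e) < k"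
  proof -
    \<comment> \<open>Threshold 0 is never undercut, so it bridges the moment between the decrement
      and the push, which restores \<open>k\<close>.\<close>
    have "peeling ((\<lambda>_. k)(src e := 0)) (A - {e}) qs d'"
      unfolding d'_def using peeling_arc[OF p e(1,2) nq] by simp
    moreover have "((\<lambda>_. k)(src e := 0))(src e := k) = (\<lambda>_. k)" by auto
    ultimately show ?thesis using peeling_push[of "(\<lambda>_. k)(src e := 0)"
      "A - {e}" qs d' "src e" k] u nq that by metis
  qed
  show "peeling (\<lambda>_. k) (A - {e}) qs d'" if "\<not> d' (src e) < k"
    using peeling_arc[OF p e(1,2) nq, of k] that by (simp add: d'_def fun_upd_idem)
qed

text \<open>Needed after a full scan, when the thresholds agree with a constant on the vertices
  only.\<close>

lemma peeling_cong:
  assumes "peeling K A qs d" "\<And>u. u < n \<Longrightarrow> K u = K' u"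
  shows "peeling K' A qs d"
proof -
  have "qs ! j < n" if "j < length qs" for j
    using nth_mem[OF that] assms(1) by (auto simp: peeling_def)
  then show ?thesis using assms(1) by (simp add: peeling_def assms(2)[symmetric])
qed

lemma peeling_length:
  assumes "peeling K A qs d"
  shows "length qs \<le> n" "u < n \<Longrightarrow> u \<notin> set qs \<Longrightarrow> length qs < n"
    "length qs = n \<Longrightarrow> set qs = {..<n}"
proof -
  have qs: "card (set qs) = length qs" "set qs \<subseteq> {..<n}"
    using assms by (auto simp: peeling_def distinct_card)
  show "length qs \<le> n" using qs card_mono[of "{..<n}" "set qs"] by simp
  show "length qs < n" if "u < n" "u \<notin> set qs"
    using that qs psubset_card_mono[of "{..<n}" "set qs"] by auto
  show "set qs = {..<n}" if "length qs = n"
    using that qs card_subset_eq[of "{..<n}" "set qs"] by auto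
qed

lemma peeling_0: "peeling (\<lambda>_. 0) {1..m} [] (\<lambda>u. card {e \<in> {1..m}. src e = u})"
  by (simp add: peeling_def)

section \<open>Lower bound from an incomplete removal, coloring from a complete one\<close>

lemma cycle_induce_verts:
  assumes "cycle p"
  shows "pre_digraph.cycle (with_proj G \<restriction> pverts G) p"
proof -
  let ?H = "with_proj G \<restriction> pverts G"
  have cas: "pre_digraph.cas ?H = cas" and vs: "pre_digraph.awalk_verts ?H = awalk_verts"
    by (intro ext compatible_cas[OF compatible_induce_subgraph]
        compatible_awalk_verts[OF compatible_induce_subgraph])+
  have "parcs G \<subseteq> arcs ?H" using tail_in_verts head_in_verts by auto
  then show ?thesis using assms
    unfolding pre_digraph.cycle_def pre_digraph.awalk_def cas vs by auto
qed

text \<open>Every unqueued vertex keeps at least \<open>k\<close> arcs to unqueued vertices. The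
  cactus property forces one with at most 1, hence \<open>k \<le> 1\<close>; for
  \<open>k = 1\<close> following these arcs yields a cycle.\<close>

lemma peeling_stuck:
  assumes p: "peeling (\<lambda>_. k) (pending qs) qs d" and "length qs < n"
  shows "k \<le> 1 \<and> (\<nexists>c. acyclic_coloring (with_proj G) k c)"
proof -
  define S where "S = {..<n} - set qs"
  have S: "S \<subseteq> verts (with_proj G)" "S \<noteq> {}"
    using assms peeling_length(1)[OF p] card_mono[of "set qs" "{..<n}"] card_length[of qs]
    by (auto simp: S_def verts) 
  have deg: "k \<le> card {a \<in> parcs G. fst a = v \<and> snd a \<in> S}" if "v \<in> S" for v
  proof -
    \<comment> \<open>Once the whole queue is processed, arcs to queued vertices no longer count, so
      \<open>d v\<close> is the exact out-degree into \<open>S\<close>.\<close>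
    have "{e \<in> {1..m} - into qs. src e = v} = {e \<in> {1..m}. src e = v \<and> dst e \<in> S}"
      by (auto simp: into_def S_def)
    moreover have "\<not> d v < k" "d v = card {e \<in> {1..m} - into qs. src e = v}"
      using p that by (auto simp: peeling_def S_def)
    ultimately show ?thesis by (simp add: card_out_arcs)
  qed
  obtain v where "v \<in> S" "card {a \<in> parcs G. fst a = v \<and> snd a \<in> S} \<le> 1"
    using directed_cactus_forest_ex_outdegree_le_1[OF cactus S] by auto
  with deg have "k \<le> 1" by (meson le_trans)
  moreover have "\<not> acyclic_coloring (with_proj G) k c" for c
  proof (cases "k = 0")
    case True
    then show ?thesis using S by (auto simp: acyclic_coloring_def)
  next
    case False
    have "\<exists>e\<in>parcs G. fst e = v \<and> snd e \<in> S" if "v \<in> S" for v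
    proof -
      have "0 < card {a \<in> parcs G. fst a = v \<and> snd a \<in> S}" using deg[OF that] False by linarith
      then have "{a \<in> parcs G. fst a = v \<and> snd a \<in> S} \<noteq> {}" by (metis card.empty less_irrefl)
      then show ?thesis by blast
    qed
    then obtain p where "cycle p" using ex_cycle_in[OF S] by auto
    then have cyc: "pre_digraph.cycle (with_proj G \<restriction> pverts G) p" by (rule cycle_induce_verts)
    show ?thesis
    proof
      assume c: "acyclic_coloring (with_proj G) k c"
      \<comment> \<open>A single color class is the whole vertex set, so the cycle found above is
        monochromatic.\<close>
      have "k = 1" using False \<open>k \<le> 1\<close> by simp
      then have "{v \<in> pverts G. c v = 1} = pverts G"
        using c by (auto simp: acyclic_coloring_def)
      then show False using c cyc \<open>k = 1\<close> by (auto simp: acyclic_coloring_def)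
    qed
  qed
  ultimately show ?thesis by blast
qed

text \<open>Colors are 0 and 1 here. For \<open>k = 2\<close> the complement swaps them, for
  \<open>k = 1\<close> it is always 0, so one coloring pass serves both cases.\<close>

definition complements_later :: "nat \<Rightarrow> nat list \<Rightarrow> nat \<Rightarrow> (nat \<Rightarrow> nat) \<Rightarrow> bool" where
  "complements_later k qs i c \<longleftrightarrow> (\<forall>j e. i \<le> j \<and> j < length qs \<and> e \<in> {1..m} \<and> src e = qs ! j \<and>
     dst e \<in> set (drop (Suc j) qs) \<longrightarrow> c (src e) = k - 1 - c (dst e))"

lemma acyclic_coloring_of_peeling:
  assumes p: "peeling (\<lambda>_. k) A qs d" and len: "length qs = n" and k: "k \<le> 2" "n = 0 \<or> 1 \<le> k"
    and c: "complements_later k qs 0 c" "\<And>u. u < n \<Longrightarrow> c u \<le> k - 1"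
  shows "acyclic_coloring (with_proj G) k (\<lambda>v. Suc (c v))"
proof -
  have "Suc ` c ` pverts G \<subseteq> {1..k}"
  proof -
    have "Suc (c u) \<le> k" if "u < n" for u using c(2)[OF that] k(2) that by linarith
    then show ?thesis by (auto simp: verts)
  qed
  moreover have False
    if cyc: "pre_digraph.cycle (with_proj G \<restriction> {v \<in> pverts G. Suc (c v) = i}) p" for i p
  proof -
    let ?H = "with_proj G \<restriction> {v \<in> pverts G. Suc (c v) = i}"
    define X where "X = fst ` set p"
    have "p \<noteq> []" "set p \<subseteq> arcs ?H"
      using cyc by (auto simp: pre_digraph.cycle_def pre_digraph.awalk_def)
    then have X: "X \<noteq> {}" and p_arcs: "\<And>a. a \<in> set p \<Longrightarrow> a \<in> parcs G \<and> Suc (c (fst a)) = i \<and>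
      Suc (c (snd a)) = i"
      by (auto simp: X_def)
    have X_closed: "snd a \<in> X" if "a \<in> set p" for a
      using pre_digraph.cycle_head_in_tails[OF cyc that] by (simp add: X_def)
    have "fst a < n" if "a \<in> set p" for a
      using tail_in_verts[of a] p_arcs[OF that] by (simp add: verts)
    then have Xqs: "X \<subseteq> set qs" using peeling_length(3)[OF p len] by (auto simp: X_def)
    then have ex: "\<exists>j. j < n \<and> qs ! j \<in> X" using X len by (metis ex_in_conv in_set_conv_nth subsetD)
    define j where "j = (LEAST j. j < n \<and> qs ! j \<in> X)"
    have j: "j < n" "qs ! j \<in> X" using LeastI_ex[OF ex] unfolding j_def by blast+
    have j_least: "qs ! j' \<notin> X" if "j' < j" for j'
      using not_less_Least[of j' "\<lambda>j. j < n \<and> qs ! j \<in> X"] that j(1) unfolding j_def by linarith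
    obtain a where a: "a \<in> set p" "fst a = qs ! j" using j(2) by (auto simp: X_def)
    have "a \<in> (\<lambda>e. (src e, dst e)) ` {1..m}"
      using p_arcs[OF a(1)] bij_betw_imp_surj_on[OF ends_bij] by simp
    then obtain e where e: "e \<in> {1..m}" "a = (src e, dst e)" by blast
    have "dst e \<in> X" using X_closed[OF a(1)] e(2) by simp
    then obtain j' where j': "j' < n" "dst e = qs ! j'"
      using Xqs len by (metis in_set_conv_nth subsetD)
    have "j' \<noteq> j" using src_neq_dst[of e] e a j' by auto
    moreover have "\<not> j' < j" using j_least[of j'] \<open>dst e \<in> X\<close> j' by auto
    ultimately have "j < j'" by simp
    have "dst e \<notin> set (take j qs)"
    proof
      assume "dst e \<in> set (take j qs)"
      then obtain i where "i < j" "qs ! i = dst e" by (auto simp: in_set_conv_nth)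
      then show False using j_least[of i] \<open>dst e \<in> X\<close> by simp
    qed
    then have "e \<in> {e \<in> {1..m}. src e = qs ! j \<and> dst e \<notin> set (take j qs)}" using e a by simp
    then have "0 < card {e \<in> {1..m}. src e = qs ! j \<and> dst e \<notin> set (take j qs)}"
      unfolding card_gt_0_iff by (intro conjI) (blast, simp)
    moreover have "card {e \<in> {1..m}. src e = qs ! j \<and> dst e \<notin> set (take j qs)} < k"
      using p j(1) len by (simp add: peeling_def)
    \<comment> \<open>The first removed vertex of the cycle has an arc to a vertex not removed
      before it, which the thresholds 0 and 1 exclude.\<close>
    ultimately have "k = 2" using k(1) by linarith
    have "dst e \<in> set (drop (Suc j) qs)"
      using nth_mem[of "j' - Suc j" "drop (Suc j) qs"] \<open>j < j'\<close> j' len by simp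
    then have "c (src e) = k - 1 - c (dst e)"
      using c(1) e a j(1) len unfolding complements_later_def by simp
    moreover have "c (src e) = c (dst e)" using p_arcs[OF a(1)] e(2) by simp
    ultimately show False using \<open>k = 2\<close> by presburger
  qed
  ultimately show ?thesis by (auto simp: acyclic_coloring_def image_image)
qed

text \<open>
  The colors \<open>c\<close> are final from position \<open>i\<close> on. A tentative color \<open>t u\<close> is never overwritten with a
  different one before it becomes final, since \<open>u\<close> has at most one arc to later positions.
\<close>

definition color_ok :: "nat \<Rightarrow> nat list \<Rightarrow> nat \<Rightarrow> (nat \<Rightarrow> nat) \<Rightarrow> (nat \<Rightarrow> nat) \<Rightarrow> bool" where
  "color_ok k qs i c t \<longleftrightarrow> complements_later k qs i c \<and>
     (\<forall>e\<in>{1..m}. src e \<in> set (take i qs) \<and> dst e \<in> set (drop i qs) \<longrightarrow> t (src e) = k - 1 - c (dst e)) \<and>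
     (\<forall>u<n. t u \<le> k - 1) \<and> (\<forall>u\<in>set (drop i qs). c u \<le> k - 1)"

text \<open>The vertex at position \<open>i\<close> makes its tentative color final and marks all
  its in-neighbors. Marks on in-neighbors at later positions do no harm, since \<open>t\<close> is
  constrained only before position \<open>i\<close>.\<close>

lemma color_ok_step:
  assumes ok: "color_ok k qs (Suc i) c t" and i: "i < length qs" and p: "peeling (\<lambda>_. k) A qs d"
    and "k \<le> 2"
  defines "w \<equiv> qs ! i"
  shows "color_ok k qs i (c(w := t w))
    (\<lambda>u. if u \<in> src ` {e \<in> {1..m}. dst e = w} then k - 1 - t w else t u)"
    (is "color_ok k qs i ?c ?t")
proof -
  have dist: "distinct qs" and sub: "set qs \<subseteq> {..<n}" using p by (auto simp: peeling_def)
  have w: "w < n" using subsetD[OF sub nth_mem[OF i]] by (simp add: w_def)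
  have drop_i: "drop i qs = w # drop (Suc i) qs" using i by (simp add: Cons_nth_drop_Suc w_def)
  have take_i: "take (Suc i) qs = take i qs @ [w]" using i
    by (simp add: take_Suc_conv_app_nth w_def)
  have "distinct (take i qs @ drop i qs)" using dist by simp
  then have wn: "w \<notin> set (take i qs)" "w \<notin> set (drop (Suc i) qs)"
    unfolding drop_i by auto
  have disj: "set (take j qs) \<inter> set (drop j qs) = {}" for j
    using dist by (metis append_take_drop_id distinct_append)
  have t: "t (src e) = k - 1 - c (dst e)"
    if "e \<in> {1..m}" "src e \<in> set (take (Suc i) qs)" "dst e \<in> set (drop (Suc i) qs)" for e
    using ok that by (auto simp: color_ok_def)
  have "complements_later k qs i ?c"
    unfolding complements_later_def
  proof (intro allI impI, elim conjE)
    fix j e assume j: "i \<le> j" "j < length qs" and e: "e \<in> {1..m}" "src e = qs ! j"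
      "dst e \<in> set (drop (Suc j) qs)"
    have "dst e \<in> set (drop (Suc i) qs)" using e(3) j(1) set_drop_subset_set_drop[of "Suc i"
      "Suc j" qs] by auto
    then have dw: "dst e \<noteq> w" using wn by auto
    show "?c (src e) = k - 1 - ?c (dst e)"
    proof (cases "j = i")
      case True
      then have "src e = w" using e(2) by (simp add: w_def)
      then show ?thesis using t[OF e(1)] take_i \<open>dst e \<in> set (drop (Suc i) qs)\<close> dw by simp
    next
      case False
      then have "src e \<noteq> w" using e(2) j i dist by (simp add: w_def nth_eq_iff_index_eq)
      moreover have "c (src e) = k - 1 - c (dst e)"
        using ok False j e unfolding color_ok_def complements_later_def
          by (metis Suc_leI le_neq_implies_less)
      ultimately show ?thesis using dw by simp
    qed
  qed
  moreover have "?t (src e) = k - 1 - ?c (dst e)"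
    if e: "e \<in> {1..m}" "src e \<in> set (take i qs)" "dst e \<in> set (drop i qs)" for e
  proof (cases "dst e = w")
    case True
    then show ?thesis using e by auto
  next
    case False
    then have de: "dst e \<in> set (drop (Suc i) qs)" using e(3) drop_i by auto
    have "src e \<notin> src ` {e \<in> {1..m}. dst e = w}"
    proof
      assume "src e \<in> src ` {e \<in> {1..m}. dst e = w}"
      then obtain e' where e': "e' \<in> {1..m}" "dst e' = w" "src e' = src e" by auto
      obtain j where j: "j < i" "j < length qs" "qs ! j = src e" using e(2)
        by (auto simp: in_set_conv_nth)
      have later: "dst e'' \<notin> set (take j qs)" if "dst e'' \<in> set (drop i qs)" for e''
        using that disj[of i] set_take_subset_set_take[of j i qs] j(1) by auto
      \<comment> \<open>Both arcs lead from \<open>qs ! j\<close> to positions from \<open>i\<close>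
        on, hence not before \<open>j\<close>; a threshold of at most 2 admits only one such
        arc.\<close>
      have "{e, e'} \<subseteq> {e \<in> {1..m}. src e = qs ! j \<and> dst e \<notin> set (take j qs)}"
        using e e' j(3) later[OF e(3)] later[of e'] drop_i by auto
      then have "card {e, e'} \<le> card {e \<in> {1..m}. src e = qs ! j \<and> dst e \<notin> set (take j qs)}"
        by (intro card_mono) simp_all
      also have "\<dots> < k" using p j(2) by (simp add: peeling_def)
      finally have "card {e, e'} < 2" using \<open>k \<le> 2\<close> by linarith
      moreover have "e \<noteq> e'" using False e'(2) by auto
      ultimately show False by simp
    qed
    moreover have "t (src e) = k - 1 - c (dst e)" using t[OF e(1)] e(2) de take_i by simp
    ultimately show ?thesis using False by simp
  qed
  moreover have "?t u \<le> k - 1" if "u < n" for u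
    using ok that by (auto simp: color_ok_def intro: diff_le_mono2)
  moreover have "?c u \<le> k - 1" if "u \<in> set (drop i qs)" for u
    using ok that w by (auto simp: color_ok_def drop_i)
  ultimately show ?thesis unfolding color_ok_def by blast
qed

end

section \<open>The program\<close>

abbreviation seq :: "com \<Rightarrow> com \<Rightarrow> com" (infixr ";;" 60) where
  "P ;; Q \<equiv> Seq P Q"

text \<open>
  Registers: 0 and 1 hold these constants, 2 and 3 hold \<open>n\<close> and \<open>m\<close>, 4 to 8 the base addresses
  of the arrays, 9 and 10 hold \<open>k\<close> and \<open>k - 1\<close>, 11 and 12 delimit the unprocessed part of the
  queue, and the others are temporary. Arcs are numbered from 1, so that 0 ends a linked list and
  arc \<open>e\<close> is stored in the cells \<open>2 e\<close> and \<open>2 e + 1\<close>.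
\<close>

definition setup_prog :: com where
  "setup_prog = Const 1 1 ;; Load 2 0 ;; Load 3 1 ;; Add 4 3 3 ;; Add 4 4 1 ;; Add 4 4 1 ;;
     Add 5 4 2 ;; Add 6 5 2 ;; Add 7 6 2 ;; Add 8 7 2"

definition build_body :: com where
  "build_body = Add 13 13 1 ;; Add 14 13 13 ;; Load 15 14 ;; Add 14 14 1 ;; Load 16 14 ;;
     Add 14 4 15 ;; Load 17 14 ;; Add 17 17 1 ;; Store 14 17 ;;
     Add 14 5 16 ;; Load 17 14 ;; Add 18 8 13 ;; Store 18 17 ;; Store 14 13"

text \<open>Register 10 holds the previous threshold: a smaller counter belongs to a vertex queued
  before, and exactly the counters equal to it give new entries.\<close>

definition scan_body :: com where
  "scan_body = Add 14 4 13 ;; Load 15 14 ;;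
     IfLess 15 10 Skip (IfLess 15 9 (Add 14 6 12 ;; Store 14 13 ;; Add 12 12 1) Skip) ;;
     Add 13 13 1"

text \<open>Counters are frozen once they fall below \<open>k\<close>, so the first comparison with
  \<open>k\<close> recognizes queued vertices without a separate mark.\<close>

definition arc_body :: com where
  "arc_body = Add 14 13 13 ;; Load 16 14 ;; Add 14 4 16 ;; Load 17 14 ;;
     IfLess 17 9 Skip
       (Sub 17 17 1 ;; Store 14 17 ;;
        IfLess 17 9 (Add 14 6 12 ;; Store 14 16 ;; Add 12 12 1) Skip) ;;
     Add 14 8 13 ;; Load 13 14"

definition drain_body :: com where
  "drain_body = Add 14 6 11 ;; Load 15 14 ;; Add 11 11 1 ;; Add 14 5 15 ;; Load 13 14 ;;
     WhileLess 0 13 arc_body"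

definition peel_body :: com where
  "peel_body = Add 10 9 0 ;; Add 9 9 1 ;; Const 13 0 ;; WhileLess 13 2 scan_body ;;
     WhileLess 11 12 drain_body"

text \<open>Tails that are already colored are overwritten too; their tentative colors are never
  read again.\<close>

definition mark_body :: com where
  "mark_body = Add 14 13 13 ;; Load 17 14 ;; Add 14 7 17 ;; Store 14 16 ;;
     Add 14 8 13 ;; Load 13 14"

definition color_body :: com where
  "color_body = Sub 18 18 1 ;; Add 14 6 18 ;; Load 15 14 ;; Add 14 7 15 ;; Load 16 14 ;;
     Add 14 4 15 ;; Store 14 16 ;; Sub 16 10 16 ;; Add 14 5 15 ;; Load 13 14 ;;
     WhileLess 0 13 mark_body"

definition output_body :: com where
  "output_body = Add 14 4 13 ;; Load 15 14 ;; Add 15 15 1 ;; Add 13 13 1 ;; Store 13 15"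

text \<open>The initial zeros of the registers supply the threshold 0, the empty queue and the start
  of the first loop counter.\<close>

definition coloring_prog :: com where
  "coloring_prog = setup_prog ;; WhileLess 13 3 build_body ;; WhileLess 12 2 peel_body ;;
     Add 18 12 0 ;; WhileLess 0 18 color_body ;;
     Store 0 9 ;; Const 13 0 ;; WhileLess 13 2 output_body"

text \<open>A singly linked list with first node \<open>e\<close>, link function \<open>x\<close>
  and null pointer 0; the third argument lists its nodes.\<close>

fun chain :: "(nat \<Rightarrow> nat) \<Rightarrow> nat \<Rightarrow> nat list \<Rightarrow> bool" where
  "chain x e [] \<longleftrightarrow> e = 0"
| "chain x e (a # l) \<longleftrightarrow> e = a \<and> a \<noteq> 0 \<and> chain x (x a) l"

lemma chain_0 [simp]: "chain x 0 l \<longleftrightarrow> l = []"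
  by (cases l) auto

lemma chain_pos:
  assumes "chain x e l" "0 < e"
  obtains l' where "l = e # l'" "chain x (x e) l'"
  using assms by (cases l) auto

lemma chain_fun_upd: "a \<notin> set l \<Longrightarrow> chain (x(a := b)) e l = chain x e l"
  by (induction l arbitrary: e) auto

definition holds_queue :: "(nat \<Rightarrow> nat) \<Rightarrow> nat list \<Rightarrow> bool" where
  "holds_queue q qs \<longleftrightarrow> (\<forall>j<length qs. q j = qs ! j)"

lemma holds_queue_snoc: "holds_queue q qs \<Longrightarrow> holds_queue (q(length qs := u)) (qs @ [u])"
  by (auto simp: holds_queue_def nth_append less_Suc_eq)

lemma nth_concat_pairs:
  "i < 2 * length ps \<Longrightarrow> concat (map (\<lambda>(u, v). [u, v]) ps) ! i =
     (if even i then fst (ps ! (i div 2)) else snd (ps ! (i div 2)))"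
proof (induction ps arbitrary: i)
  case (Cons p ps)
  show ?case
  proof (cases "i < 2")
    case True
    then have "i = 0 \<or> i = 1" by auto
    then show ?thesis by (auto split: prod.split)
  next
    case False
    then obtain i' where "i = Suc (Suc i')" by (metis add_2_eq_Suc le_Suc_ex not_less)
    then show ?thesis using Cons by (auto split: prod.split)
  qed
qed simp

lemma length_concat_pairs: "length (concat (map (\<lambda>(u, v). [u, v]) ps)) = 2 * length ps"
  by (induction ps) auto

text \<open>The largest address is \<open>bx + m\<close>, that is \<open>4 * n + 3 * m + 2\<close>:
  the input, four arrays of \<open>n\<close> cells and the links of the arcs 0 to
  \<open>m\<close>.\<close>

locale arc_list_ram = arc_list +
  fixes W :: nat
  assumes W: "4 * (n + m + 1) \<le> W"
begin

definition bd :: nat where "bd = 2 * m + 2"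
definition bf :: nat where "bf = bd + n"
definition bq :: nat where "bq = bf + n"
definition bt :: nat where "bt = bq + n"
definition bx :: nat where "bx = bt + n"

text \<open>
  The arrays hold the remaining out-degrees and later the colors (\<open>d\<close>), the first arcs of the
  in-lists (\<open>f\<close>), the queue (\<open>q\<close>), the tentative colors (\<open>t\<close>) and the links of the in-lists (\<open>x\<close>).
\<close>

definition mem :: "(nat \<Rightarrow> nat) \<Rightarrow> (nat \<Rightarrow> nat) \<Rightarrow> (nat \<Rightarrow> nat) \<Rightarrow> (nat \<Rightarrow> nat) \<Rightarrow> (nat \<Rightarrow> nat) \<Rightarrow>
    nat \<Rightarrow> nat" where
  "mem d f q t x a =
     (if a = 0 then n else if a = 1 then m
      else if a < bd then if even a then src (a div 2) else dst (a div 2)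
      else if a < bf then d (a - bd) else if a < bq then f (a - bf)
      else if a < bt then q (a - bq) else if a < bx then t (a - bt) else x (a - bx))"

lemmas base_defs = bd_def bf_def bq_def bt_def bx_def

lemma mem_reads [simp]:
  "u < n \<Longrightarrow> mem d f q t x (bd + u) = d u"
  "u < n \<Longrightarrow> mem d f q t x (bf + u) = f u"
  "u < n \<Longrightarrow> mem d f q t x (bq + u) = q u"
  "u < n \<Longrightarrow> mem d f q t x (bt + u) = t u"
  "mem d f q t x (bx + u) = x u"
  by (simp_all add: mem_def base_defs)

lemma mem_arcs [simp]:
  assumes "e \<noteq> 0" "e \<le> m"
  shows "mem d f q t x (e + e) = src e" "mem d f q t x (Suc (e + e)) = dst e"
proof -
  have "(e + e) div 2 = e" "Suc (e + e) div 2 = e" by auto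
  then show "mem d f q t x (e + e) = src e" "mem d f q t x (Suc (e + e)) = dst e"
    using assms by (auto simp: mem_def bd_def)
qed

text \<open>Turns memory updates into updates of the abstract arrays, so that symbolic execution
  never has to compare addresses.\<close>

lemma mem_writes [simp]:
  "u < n \<Longrightarrow> (mem d f q t x)(bd + u := a) = mem (d(u := a)) f q t x"
  "u < n \<Longrightarrow> (mem d f q t x)(bf + u := a) = mem d (f(u := a)) q t x"
  "u < n \<Longrightarrow> (mem d f q t x)(bq + u := a) = mem d f (q(u := a)) t x"
  "u < n \<Longrightarrow> (mem d f q t x)(bt + u := a) = mem d f q (t(u := a)) x"
  "(mem d f q t x)(bx + u := a) = mem d f q t (x(u := a))"
  by (auto simp: mem_def base_defs fun_eq_iff)

lemma word_bounds [simp]: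
  "1 \<le> W" "Suc 0 \<le> W" "Suc (Suc 0) \<le> W" "2 \<le> W"
  "u \<le> n \<Longrightarrow> u \<le> W" "u \<le> m \<Longrightarrow> u \<le> W"
  "u < n \<Longrightarrow> Suc u \<le> W" "u < m \<Longrightarrow> Suc u \<le> W"
  "u < n \<Longrightarrow> bd + u \<le> W" "u < n \<Longrightarrow> bf + u \<le> W" "u < n \<Longrightarrow> bq + u \<le> W" "u < n \<Longrightarrow> bt + u \<le> W"
  "u \<le> m \<Longrightarrow> bx + u \<le> W" "u \<le> m \<Longrightarrow> u + u \<le> W" "u \<le> m \<Longrightarrow> Suc (u + u) \<le> W"
  using W by (simp_all add: base_defs)

definition base :: "(nat \<Rightarrow> nat) \<Rightarrow> bool" where
  "base R \<longleftrightarrow> R 0 = 0 \<and> R 1 = 1 \<and> R 2 = n \<and> R 3 = m \<and> R 4 = bd \<and> R 5 = bf \<and> R 6 = bq \<and>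
     R 7 = bt \<and> R 8 = bx"

lemma base_fun_upd [simp]: "8 < r \<Longrightarrow> base (R(r := a)) = base R"
  by (simp add: base_def)

lemma baseD:
  assumes "base R"
  shows "R 0 = 0" "R 1 = 1" "R (Suc 0) = 1" "R 2 = n" "R 3 = m" "R 4 = bd" "R 5 = bf" "R 6 = bq"
    "R 7 = bt" "R 8 = bx"
  using assms by (simp_all add: base_def)

lemma initial_state_encode:
  "initial_state (encode n es) = (\<lambda>_. 0, mem (\<lambda>_. 0) (\<lambda>_. 0) (\<lambda>_. 0) (\<lambda>_. 0) (\<lambda>_. 0))"
proof -
  have "(if a < length (encode n es) then encode n es ! a else 0) =
      mem (\<lambda>_. 0) (\<lambda>_. 0) (\<lambda>_. 0) (\<lambda>_. 0) (\<lambda>_. 0) a" for a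
  proof (cases "a < 2")
    case True
    then have "a = 0 \<or> a = 1" by auto
    then show ?thesis by (auto simp: encode_def mem_def m_def)
  next
    case False
    then obtain i where "a = Suc (Suc i)" by (metis add_2_eq_Suc le_Suc_ex not_less)
    then show ?thesis
      by (simp add: encode_def mem_def bd_def length_concat_pairs nth_concat_pairs src_def dst_def m_def)
  qed
  then show ?thesis by (simp add: initial_state_def)
qed

section \<open>Out-degrees and in-lists\<close>

definition degree :: "nat \<Rightarrow> nat \<Rightarrow> nat" where
  "degree e u = card {e' \<in> {1..e}. src e' = u}"

text \<open>Reversed because each arc is inserted at the front.\<close>

definition in_list :: "nat \<Rightarrow> nat \<Rightarrow> nat list" where
  "in_list e v = filter (\<lambda>e'. dst e' = v) (rev [1..<Suc e])"

lemma degree_0: "degree 0 = (\<lambda>_. 0)"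
  by (simp add: degree_def fun_eq_iff)

lemma degree_le: "degree e u \<le> e"
proof -
  have "degree e u \<le> card {1..e}" unfolding degree_def by (rule card_mono) auto
  then show ?thesis by simp
qed

lemma degree_Suc: "degree (Suc e) = (degree e)(src (Suc e) := Suc (degree e (src (Suc e))))"
proof
  fix u
  have "{e' \<in> {1..Suc e}. src e' = u} =
      (if src (Suc e) = u then insert (Suc e) {e' \<in> {1..e}. src e' = u} else {e' \<in> {1..e}. src e' = u})"
    by (auto simp: le_Suc_eq)
  then show "degree (Suc e) u = ((degree e)(src (Suc e) := Suc (degree e (src (Suc e))))) u"
    by (simp add: degree_def)
qed

lemma in_list_Suc: "in_list (Suc e) v = (if dst (Suc e) = v then Suc e # in_list e v else in_list e v)"
  by (simp add: in_list_def)

lemma set_in_list: "set (in_list e v) = {e' \<in> {1..e}. dst e' = v}"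
  by (auto simp: in_list_def)

lemma distinct_in_list: "distinct (in_list e v)"
  by (simp add: in_list_def)

abbreviation in_lists :: "nat \<Rightarrow> (nat \<Rightarrow> nat) \<Rightarrow> (nat \<Rightarrow> nat) \<Rightarrow> bool" where
  "in_lists e f x \<equiv> \<forall>v<n. chain x (f v) (in_list e v)"

lemma in_lists_Suc:
  assumes "in_lists e f x"
  shows "in_lists (Suc e) (f(dst (Suc e) := Suc e)) (x(Suc e := f (dst (Suc e))))"
proof (intro allI impI)
  fix v assume "v < n"
  then have "chain (x(Suc e := f (dst (Suc e)))) (f v) (in_list e v)"
    using assms by (subst chain_fun_upd) (auto simp: set_in_list)
  then show "chain (x(Suc e := f (dst (Suc e)))) ((f(dst (Suc e) := Suc e)) v) (in_list (Suc e) v)"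
    by (auto simp: in_list_Suc)
qed

text \<open>As in all loop invariants below, the credit is a rounded cost for each outstanding
  iteration plus \<open>T0\<close> for what follows the loop. The inductive form lets case analysis
  expose the arrays in memory.\<close>

inductive build_inv :: "int \<Rightarrow> state \<Rightarrow> int \<Rightarrow> bool" for T0 where
  "base R \<Longrightarrow> R 13 \<le> m \<Longrightarrow> R 9 = 0 \<Longrightarrow> R 10 = 0 \<Longrightarrow> R 11 = 0 \<Longrightarrow> R 12 = 0 \<Longrightarrow> in_lists (R 13) f x \<Longrightarrow>
   20 * (int m - int (R 13)) + T0 \<le> T \<Longrightarrow>
   build_inv T0 (R, mem (degree (R 13)) f (\<lambda>_. 0) (\<lambda>_. 0) x) T"

lemma wp_build:
  assumes "build_inv T0 s T" "1 \<le> T0"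
    and exit: "\<And>R f x T. base R \<Longrightarrow> R 9 = 0 \<Longrightarrow> R 10 = 0 \<Longrightarrow> R 11 = 0 \<Longrightarrow> R 12 = 0 \<Longrightarrow> in_lists m f x \<Longrightarrow>
      T0 - 1 \<le> T \<Longrightarrow> Q (R, mem (degree m) f (\<lambda>_. 0) (\<lambda>_. 0) x) T"
  shows "wp W (WhileLess 13 3 build_body) Q s T"
  using assms(1)
proof (rule wp_While)
  show "0 \<le> T'" if "build_inv T0 s' T'" for s' T'
    using that assms(2) by cases simp
  show "wp W build_body (build_inv T0) (R, M) (T' - 1)"
    if "build_inv T0 (R, M) T'" "R 13 < R 3" for R M T'
    using that(1)
  proof cases
    case (1 f x)
    note b = baseD[OF 1(2)]
    let ?e = "Suc (R 13)"
    have e: "?e \<le> m" "1 \<le> ?e" using that(2) b by auto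
    note ends = ends_less[OF e(2,1)]
    have deg: "Suc (degree (R 13) (src ?e)) \<le> W"
      using degree_le[of "R 13" "src ?e"] e(1) by (intro word_bounds(8)) simp
    have reads: "mem d f' q t x' (Suc (Suc (R 13 + R 13))) = src ?e"
      "mem d f' q t x' (Suc (Suc (Suc (R 13 + R 13)))) = dst ?e" for d f' q t x'
      using mem_arcs[of ?e] e by simp_all
    have link: "(mem d f' q t x')(Suc (bx + R 13) := a) = mem d f' q t (x'(?e := a))"
      for d f' q t x' a
      using mem_writes(5)[of d f' q t x' ?e a] by simp
    have bnds: "Suc (Suc (R 13 + R 13)) \<le> W" "Suc (Suc (Suc (R 13 + R 13))) \<le> W"
      "Suc (bx + R 13) \<le> W"
      using word_bounds(13-15)[of ?e] e by simp_all
    have "build_inv T0 (R', mem (degree ?e) (f(dst ?e := ?e)) (\<lambda>_. 0) (\<lambda>_. 0) (x(?e := f (dst ?e)))) (T' - 15)"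
      if "base R'" "R' 13 = ?e" "R' 9 = 0" "R' 10 = 0" "R' 11 = 0" "R' 12 = 0" for R'
      using build_inv.intros[of R' "x(?e := f (dst ?e))" "f(dst ?e := ?e)" T0 "T' - 15"] that e
        in_lists_Suc[OF 1(8)] 1(9) by simp
    then show ?thesis
      using e ends deg bnds 1 b
      by (simp add: build_body_def wp_simps reads link degree_Suc)
  qed
  show "Q (R, M) (T' - 1)" if "build_inv T0 (R, M) T'" "\<not> R 13 < R 3" for R M T'
    using that(1)
  proof cases
    case (1 f x)
    then have "R 13 = m" using that(2) baseD by simp
    then show ?thesis using 1 exit by simp
  qed
qed

section \<open>Emptying the queue, scanning at a raised threshold, and the removal rounds\<close>

inductive arc_inv :: "(nat \<Rightarrow> nat) \<Rightarrow> (nat \<Rightarrow> nat) \<Rightarrow> (nat \<Rightarrow> nat) \<Rightarrow> nat \<Rightarrow> nat \<Rightarrow> int \<Rightarrow> state \<Rightarrow> int \<Rightarrow> bool"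
  for f t x k h T0 where
  "base R \<Longrightarrow> R 9 = k \<Longrightarrow> R 10 = k - 1 \<Longrightarrow> R 11 = Suc h \<Longrightarrow> R 12 = length qs \<Longrightarrow> h < length qs \<Longrightarrow>
   holds_queue q qs \<Longrightarrow> chain x (R 13) l \<Longrightarrow> distinct l \<Longrightarrow> set l \<subseteq> {1..m} \<Longrightarrow> dst ` set l \<subseteq> {qs ! h} \<Longrightarrow>
   peeling (\<lambda>_. k) (pending (take (Suc h) qs) \<union> set l) qs d \<Longrightarrow>
   20 * (int n - int h - 1) + 20 * int (card (pending (take (Suc h) qs) \<union> set l)) + T0 \<le> T \<Longrightarrow>
   arc_inv f t x k h T0 (R, mem d f q t x) T"

inductive drain_inv :: "(nat \<Rightarrow> nat) \<Rightarrow> (nat \<Rightarrow> nat) \<Rightarrow> (nat \<Rightarrow> nat) \<Rightarrow> nat \<Rightarrow> int \<Rightarrow> state \<Rightarrow> int \<Rightarrow> bool"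
  for f t x k T0 where
  "base R \<Longrightarrow> R 9 = k \<Longrightarrow> R 10 = k - 1 \<Longrightarrow> R 11 \<le> length qs \<Longrightarrow> R 12 = length qs \<Longrightarrow>
   holds_queue q qs \<Longrightarrow> peeling (\<lambda>_. k) (pending (take (R 11) qs)) qs d \<Longrightarrow>
   20 * (int n - int (R 11)) + 20 * int (card (pending (take (R 11) qs))) + T0 \<le> T \<Longrightarrow>
   drain_inv f t x k T0 (R, mem d f q t x) T"

lemma wp_arc_body:
  assumes "arc_inv f t x k h T0 (R, M) T" "R 0 < R 13"
  shows "wp W arc_body (arc_inv f t x k h T0) (R, M) (T - 1)"
  using assms(1)
proof cases
  case (1 qs q l d)
  note b = baseD[OF 1(2)]
  let ?e = "R 13"
  obtain l' where l: "l = ?e # l'" "chain x (x ?e) l'"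
    using chain_pos[OF 1(9)] assms(2) b by auto
  have e: "?e \<noteq> 0" "?e \<le> m" "1 \<le> ?e" using 1(11) l(1) by auto
  note ends = ends_less[OF e(3,2)]
  \<comment> \<open>The untraversed arcs are those to unprocessed vertices and the rest of the
    current in-list. Pushes only append to \<open>qs\<close>, so the processed prefix stays
    fixed.\<close>
  let ?A = "pending (take (Suc h) qs) \<union> set l"
  let ?A' = "pending (take (Suc h) qs) \<union> set l'"
  have dst: "dst ?e = qs ! h" using 1(12) l(1) by auto
  have "qs ! h \<in> set (take (Suc h) qs)" using 1(7) by (simp add: take_Suc_conv_app_nth)
  then have "?e \<notin> pending (take (Suc h) qs)" using dst e by (simp add: into_def)
  then have A: "?A - {?e} = ?A'" "?e \<in> ?A" using l(1) 1(10) by auto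
  have fin: "finite ?A" by simp
  have cA: "int (card ?A) = int (card ?A') + 1"
    using card.remove[OF fin A(2)] unfolding A(1) by simp
  have dq: "dst ?e \<in> set qs" using 1(7) dst by simp
  have l': "distinct l'" "set l' \<subseteq> {1..m}" "dst ` set l' \<subseteq> {qs ! h}" using 1(10-12) l(1) by auto
  have step: "arc_inv f t x k h T0 (R', mem d' f q' t x) T'"
    if R': "base R'" "R' 9 = k" "R' 10 = k - 1" "R' 11 = Suc h" "R' 12 = length qs'" "R' 13 = x ?e"
      and q': "holds_queue q' qs'" "qs' = qs \<or> qs' = qs @ [src ?e]"
      and p: "peeling (\<lambda>_. k) (?A - {?e}) qs' d'" and T': "T \<le> T' + 20"
    for R' d' q' qs' T'
  proof (rule arc_inv.intros[OF R'(1-5) _ q'(1) _ l'(1,2)])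
    have tk: "take (Suc h) qs' = take (Suc h) qs" and nth: "qs' ! h = qs ! h" and "h < length qs'"
      using q'(2) 1(7) by (auto simp: nth_append)
    then show "h < length qs'" by simp
    show "chain x (R' 13) l'" using l(2) R'(6) by simp
    show "dst ` set l' \<subseteq> {qs' ! h}" using l'(3) nth by simp
    show "peeling (\<lambda>_. k) (pending (take (Suc h) qs') \<union> set l') qs' d'" using p A(1) tk by simp
    show "20 * (int n - int h - 1) + 20 * int (card (pending (take (Suc h) qs') \<union> set l')) + T0 \<le> T'"
      using 1(14) cA T' unfolding tk by linarith
  qed
  note r = 1(1-6) b e ends
  show ?thesis
  proof (cases "d (src ?e) < k")
    case True
    then have "src ?e \<in> set qs" using 1(13) ends by (auto simp: peeling_def)
    note p = peeling_arc_queued[OF 1(13) A(2) dq this]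
    show ?thesis
      by (simp add: arc_body_def wp_simps r True, rule step[OF _ _ _ _ _ _ 1(8) _ p])
        (simp_all add: r)
  next
    case False
    then have nq: "src ?e \<notin> set qs" using 1(13) ends by (auto simp: peeling_def)
    note len = peeling_length(2)[OF 1(13) ends(1) nq]
    have p: "d (src ?e) - Suc 0 < k \<Longrightarrow>
        peeling (\<lambda>_. k) (?A - {?e}) (qs @ [src ?e]) (d(src ?e := d (src ?e) - Suc 0))"
      "\<not> d (src ?e) - Suc 0 < k \<Longrightarrow>
        peeling (\<lambda>_. k) (?A - {?e}) qs (d(src ?e := d (src ?e) - Suc 0))"
      using peeling_arc_step[OF 1(13) A(2) dq False] by simp_all
    show ?thesis
    proof (cases "d (src ?e) - Suc 0 < k")
      case True
      show ?thesis
        by (simp add: arc_body_def wp_simps r True False len,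
            rule step[OF _ _ _ _ _ _ holds_queue_snoc[OF 1(8)] _ p(1)[OF True]])
          (simp_all add: r)
    next
      case ge: False
      show ?thesis
        by (simp add: arc_body_def wp_simps r ge False, rule step[OF _ _ _ _ _ _ 1(8) _ p(2)[OF ge]])
          (simp_all add: r)
    qed
  qed
qed

lemma wp_drain:
  assumes "drain_inv f t x k T0 s T" "1 \<le> T0" and lists: "in_lists m f x"
    and exit: "\<And>R q d qs T. base R \<Longrightarrow> R 9 = k \<Longrightarrow> R 10 = k - 1 \<Longrightarrow> R 11 = length qs \<Longrightarrow> R 12 = length qs \<Longrightarrow>
      holds_queue q qs \<Longrightarrow> peeling (\<lambda>_. k) (pending qs) qs d \<Longrightarrow> T0 - 1 \<le> T \<Longrightarrow> Q (R, mem d f q t x) T"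
  shows "wp W (WhileLess 11 12 drain_body) Q s T"
  using assms(1)
proof (rule wp_While)
  show "0 \<le> T'" if "drain_inv f t x k T0 s' T'" for s' T'
    using that
  proof cases
    case (1 R qs q d)
    then show ?thesis using peeling_length(1)[OF 1(8)] assms(2) by simp
  qed
  show "Q (R, M) (T' - 1)" if "drain_inv f t x k T0 (R, M) T'" "\<not> R 11 < R 12" for R M T'
    using that(1)
  proof cases
    case (1 qs q d)
    then have "R 11 = length qs" using that(2) by simp
    then show ?thesis using 1 exit[of R qs q d "T' - 1"] peeling_length(1)[OF 1(8)] by simp
  qed
  show "wp W drain_body (drain_inv f t x k T0) (R, M) (T' - 1)"
    if "drain_inv f t x k T0 (R, M) T'" "R 11 < R 12" for R M T'
    using that(1)
  proof cases
    case (1 qs q d)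
    note b = baseD[OF 1(2)]
    let ?h = "R 11"
    have h: "?h < length qs" "?h < n" using that(2) 1(6) peeling_length(1)[OF 1(8)] by auto
    let ?w = "qs ! ?h"
    have q: "q ?h = ?w" using 1(7) h(1) by (simp add: holds_queue_def)
    have w: "?w < n" using 1(8) nth_mem[OF h(1)] by (auto simp: peeling_def)
    let ?l = "in_list m ?w"
    have l: "chain x (f ?w) ?l" "distinct ?l" "set ?l \<subseteq> {1..m}" "dst ` set ?l \<subseteq> {?w}"
      using lists w distinct_in_list by (auto simp: set_in_list)
    \<comment> \<open>Dequeuing changes nothing yet: the arcs that stop being pending are exactly
      the in-list about to be traversed.\<close>
    have split: "pending (take (Suc ?h) qs) \<union> set ?l = pending (take ?h qs)"
    proof -
      have "?w \<notin> set (take ?h qs)"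
        using 1(8) h(1) distinct_take[of qs "Suc ?h"]
          by (simp add: peeling_def take_Suc_conv_app_nth)
      then show ?thesis
        using h(1) by (auto simp: into_def set_in_list take_Suc_conv_app_nth)
    qed
    have inner: "wp W (WhileLess 0 13 arc_body) (drain_inv f t x k T0) (R', mem d f q t x) (T' - 6)"
      if R': "base R'" "R' 9 = k" "R' 10 = k - 1" "R' 11 = Suc ?h" "R' 12 = length qs"
        "R' 13 = f ?w"
      for R'
    \<comment> \<open>The 20 credits of the dequeued vertex pay the six steps up to here; 5 of the
      rest are reserved and cover the final test of the inner loop.\<close>
    proof (rule wp_While[where I = "arc_inv f t x k ?h (T0 + 5)"])
      show "arc_inv f t x k ?h (T0 + 5) (R', mem d f q t x) (T' - 6)"
        by (rule arc_inv.intros[where qs = qs and l = ?l])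
          (use R' 1 h l split in \<open>auto simp del: One_nat_def\<close>)
      show "0 \<le> T''" if "arc_inv f t x k ?h (T0 + 5) s'' T''" for s'' T''
        using that
      proof cases
        case (1 R qs q l d)
        then show ?thesis using peeling_length(1)[OF 1(13)] assms(2) by simp
      qed
      show "wp W arc_body (arc_inv f t x k ?h (T0 + 5)) (R, M) (T'' - 1)"
        if "arc_inv f t x k ?h (T0 + 5) (R, M) T''" "R 0 < R 13" for R M T''
        using that by (rule wp_arc_body)
      show "drain_inv f t x k T0 (R'', M'') (T'' - 1)"
        if "arc_inv f t x k ?h (T0 + 5) (R'', M'') T''" "\<not> R'' 0 < R'' 13" for R'' M'' T''
        using that(1)
      proof cases
        case (1 qs q l d)
        then have "R'' 13 = 0" using that(2) baseD(1)[OF 1(2)] by simp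
        then have "l = []" using 1(9) by simp
        then show ?thesis unfolding 1(1)
          by (intro drain_inv.intros[where qs = qs]) (use 1 in auto)
      qed
    qed
    show ?thesis
      using h q w b 1 by (simp add: drain_body_def wp_simps inner)
  qed
qed

text \<open>\<open>qs0\<close> is the fully processed queue of the previous threshold. No arc is
  traversed during the scan, so \<open>pending qs0\<close> stays fixed and new entries form the
  unprocessed part of the queue.\<close>

inductive scan_inv :: "(nat \<Rightarrow> nat) \<Rightarrow> (nat \<Rightarrow> nat) \<Rightarrow> (nat \<Rightarrow> nat) \<Rightarrow> nat \<Rightarrow> nat list \<Rightarrow> int \<Rightarrow> state \<Rightarrow> int \<Rightarrow> bool"
  for f t x k qs0 T0 where
  "base R \<Longrightarrow> R 9 = Suc k \<Longrightarrow> R 10 = k \<Longrightarrow> R 11 = length qs0 \<Longrightarrow> R 12 = length qs \<Longrightarrow> R 13 \<le> n \<Longrightarrow>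
   length qs0 \<le> length qs \<Longrightarrow> take (length qs0) qs = qs0 \<Longrightarrow> holds_queue q qs \<Longrightarrow>
   peeling (\<lambda>u. if u < R 13 then Suc k else k) (pending qs0) qs d \<Longrightarrow>
   10 * (int n - int (R 13)) + T0 \<le> T \<Longrightarrow>
   scan_inv f t x k qs0 T0 (R, mem d f q t x) T"

lemma wp_scan:
  assumes "scan_inv f t x k qs0 T0 s T" "1 \<le> T0"
    and exit: "\<And>R q d qs T. base R \<Longrightarrow> R 9 = Suc k \<Longrightarrow> R 10 = k \<Longrightarrow> R 11 = length qs0 \<Longrightarrow> R 12 = length qs \<Longrightarrow>
      length qs0 \<le> length qs \<Longrightarrow> take (length qs0) qs = qs0 \<Longrightarrow> holds_queue q qs \<Longrightarrow>
      peeling (\<lambda>_. Suc k) (pending qs0) qs d \<Longrightarrow> T0 - 1 \<le> T \<Longrightarrow> Q (R, mem d f q t x) T"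
  shows "wp W (WhileLess 13 2 scan_body) Q s T"
  using assms(1)
proof (rule wp_While)
  show "0 \<le> T'" if "scan_inv f t x k qs0 T0 s' T'" for s' T'
    using that assms(2) by cases simp
  show "Q (R, M) (T' - 1)" if "scan_inv f t x k qs0 T0 (R, M) T'" "\<not> R 13 < R 2" for R M T'
    using that(1)
  proof cases
    case (1 qs q d)
    then have v: "R 13 = n" using that(2) baseD(4)[OF 1(2)] by simp
    have "peeling (\<lambda>_. Suc k) (pending qs0) qs d"
      by (rule peeling_cong[OF 1(11)]) (simp add: v)
    then show ?thesis using 1 v exit[of R qs q d "T' - 1"] by simp
  qed
  show "wp W scan_body (scan_inv f t x k qs0 T0) (R, M) (T' - 1)"
    if "scan_inv f t x k qs0 T0 (R, M) T'" "R 13 < R 2" for R M T'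
    using that(1)
  proof cases
    case (1 qs q d)
    note b = baseD[OF 1(2)]
    let ?v = "R 13"
    let ?K = "\<lambda>v u. if u < v then Suc k else k"
    have v: "?v < n" using that(2) b by simp
    have K: "(?K ?v)(?v := Suc k) = ?K (Suc ?v)" by (auto simp: less_Suc_eq)
    have memq: "?v \<in> set qs \<longleftrightarrow> d ?v < k" using 1(11) v by (simp add: peeling_def)
    have step: "scan_inv f t x k qs0 T0 (R', mem d f q' t x) T''"
      if R': "base R'" "R' 9 = Suc k" "R' 10 = k" "R' 11 = length qs0" "R' 12 = length qs'"
        "R' 13 = Suc ?v"
        and q': "holds_queue q' qs'" "qs' = qs \<or> qs' = qs @ [?v]"
        and p: "peeling (?K (Suc ?v)) (pending qs0) qs' d" and T': "T' \<le> T'' + 10"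
      for R' q' qs' T''
    proof (rule scan_inv.intros[OF R'(1-5) _ _ _ q'(1)])
      show "R' 13 \<le> n" using R'(6) v by simp
      show "length qs0 \<le> length qs'" "take (length qs0) qs' = qs0" using q'(2) 1(8,9) by auto
      show "peeling (?K (R' 13)) (pending qs0) qs' d" using p R'(6) by simp
      show "10 * (int n - int (R' 13)) + T0 \<le> T''" using 1(12) T' R'(6) by simp
    qed
    note r = 1(1-6) b v
    consider "d ?v < k" | "\<not> d ?v < k" "d ?v < Suc k" | "\<not> d ?v < Suc k" by blast
    then show ?thesis
    proof cases
      case lt: 1
      have p: "peeling (?K (Suc ?v)) (pending qs0) qs d"
        using peeling_raise[OF 1(11), of ?v "Suc k"] lt memq K by simp
      show ?thesis
        by (simp add: scan_body_def wp_simps r lt, rule step[OF _ _ _ _ _ _ 1(10) _ p])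
          (simp_all add: r)
    next
      case eq: 2
      have nq: "?v \<notin> set qs" using eq memq by simp
      have p: "peeling (?K (Suc ?v)) (pending qs0) (qs @ [?v]) d"
        using peeling_push[OF 1(11) v nq eq(2)] K by simp
      show ?thesis
        by (simp add: scan_body_def wp_simps r eq peeling_length(2)[OF 1(11) v nq],
            rule step[OF _ _ _ _ _ _ holds_queue_snoc[OF 1(10)] _ p])
          (simp_all add: r)
    next
      case gt: 3
      have p: "peeling (?K (Suc ?v)) (pending qs0) qs d"
        using peeling_keep[OF 1(11), of ?v "Suc k"] gt memq K by simp
      have "\<not> d ?v < k" using gt by simp
      then show ?thesis
        by (simp add: scan_body_def wp_simps r gt, intro step[OF _ _ _ _ _ _ 1(10) _ p])
          (simp_all add: r)
    qed
  qed
qed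

text \<open>At most two rounds remain. A round is charged 10 per vertex for the scan, 20 per vertex
  and 20 per arc for emptying the queue, and 10 for the rest, although no vertex is processed in
  both rounds.\<close>

inductive peel_inv :: "(nat \<Rightarrow> nat) \<Rightarrow> (nat \<Rightarrow> nat) \<Rightarrow> (nat \<Rightarrow> nat) \<Rightarrow> int \<Rightarrow> state \<Rightarrow> int \<Rightarrow> bool"
  for f t x T0 where
  "base R \<Longrightarrow> R 9 \<le> 2 \<Longrightarrow> R 10 = R 9 - 1 \<Longrightarrow> R 11 = length qs \<Longrightarrow> R 12 = length qs \<Longrightarrow>
   holds_queue q qs \<Longrightarrow> peeling (\<lambda>_. R 9) (pending qs) qs d \<Longrightarrow>
   (\<And>r c. r < R 9 \<Longrightarrow> \<not> acyclic_coloring (with_proj G) r c) \<Longrightarrow>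
   (2 - int (R 9)) * (30 * int n + 20 * int m + 10) + T0 \<le> T \<Longrightarrow>
   peel_inv f t x T0 (R, mem d f q t x) T"

lemma wp_peel:
  assumes "peel_inv f t x T0 s T" "1 \<le> T0" and lists: "in_lists m f x"
    and exit: "\<And>R q d qs T. base R \<Longrightarrow> R 9 \<le> 2 \<Longrightarrow> R 10 = R 9 - 1 \<Longrightarrow> R 12 = n \<Longrightarrow> length qs = n \<Longrightarrow>
      holds_queue q qs \<Longrightarrow> peeling (\<lambda>_. R 9) (pending qs) qs d \<Longrightarrow>
      (\<And>r c. r < R 9 \<Longrightarrow> \<not> acyclic_coloring (with_proj G) r c) \<Longrightarrow> T0 - 1 \<le> T \<Longrightarrow>
      Q (R, mem d f q t x) T"
  shows "wp W (WhileLess 12 2 peel_body) Q s T"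
  using assms(1)
proof (rule wp_While)
  show "0 \<le> T'" if "peel_inv f t x T0 s' T'" for s' T'
    using that
  proof cases
    case (1 R qs q d)
    have "0 \<le> (2 - int (R 9)) * (30 * int n + 20 * int m + 10)" using 1(3)
      by (intro mult_nonneg_nonneg) simp_all
    then show ?thesis using 1(10) assms(2) by linarith
  qed
  show "Q (R, M) (T' - 1)" if "peel_inv f t x T0 (R, M) T'" "\<not> R 12 < R 2" for R M T'
    using that(1)
  proof cases
    case (1 qs q d)
    then have "length qs = n" using that(2) baseD(4)[OF 1(2)] peeling_length(1)[OF 1(8)] by simp
    moreover have "0 \<le> (2 - int (R 9)) * (30 * int n + 20 * int m + 10)"
      using 1(3) by (intro mult_nonneg_nonneg) simp_all
    then have "T0 - 1 \<le> T' - 1" using 1(10) by linarith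
    ultimately show ?thesis using 1 exit[of R qs q d "T' - 1"] by simp
  qed
  show "wp W peel_body (peel_inv f t x T0) (R, M) (T' - 1)"
    if "peel_inv f t x T0 (R, M) T'" "R 12 < R 2" for R M T'
    using that(1)
  proof cases
    case (1 qs0 q d)
    note b = baseD[OF 1(2)]
    let ?k = "R 9"
    have len: "length qs0 < n" using that(2) 1(6) b by simp
    \<comment> \<open>Both conclusions are used: the first keeps the raised threshold at most 2, the
      second extends the lower bound on the number of colors.\<close>
    have stuck: "?k \<le> 1" "\<And>c. \<not> acyclic_coloring (with_proj G) ?k c"
      using peeling_stuck[OF 1(8) len] by auto
    then have lower: "\<not> acyclic_coloring (with_proj G) r c" if "r < Suc ?k" for r c
      using that 1(9) by (cases "r = ?k") auto
    define T1 where "T1 = (2 - int (Suc ?k)) * (30 * int n + 20 * int m + 10) + T0 + 1"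
    have "0 \<le> (2 - int (Suc ?k)) * (30 * int n + 20 * int m + 10)"
      using stuck(1) by (intro mult_nonneg_nonneg) simp_all
    then have T1: "1 \<le> T1" using assms(2) by (simp add: T1_def)
    have T': "T1 + 30 * int n + 20 * int m + 9 \<le> T'"
      using 1(10) by (simp add: T1_def algebra_simps)
    have pend: "card (pending qs) \<le> m" for qs
      using card_mono[of "{1..m}" "pending qs"] by auto
    have "wp W (WhileLess 13 2 scan_body) (wp W (WhileLess 11 12 drain_body) (peel_inv f t x T0))
        (R', mem d f q t x) (T' - 4)"
      if R': "base R'" "R' 9 = Suc ?k" "R' 10 = ?k" "R' 11 = length qs0" "R' 12 = length qs0"
        "R' 13 = 0"
      for R'
    proof (rule wp_scan)
      show "scan_inv f t x ?k qs0 (T1 + 20 * int n + 20 * int m + 1) (R', mem d f q t x) (T' - 4)"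
        by (rule scan_inv.intros[OF R'(1-5) _ _ _ 1(7)]) (use R'(6) 1(8) T' in simp_all)
      show "1 \<le> T1 + 20 * int n + 20 * int m + 1" using T1 by simp
      fix R q d qs T
      assume R: "base R" "R 9 = Suc ?k" "R 10 = ?k" "R 11 = length qs0" "R 12 = length qs"
        and qs: "length qs0 \<le> length qs" "take (length qs0) qs = qs0" "holds_queue q qs"
          "peeling (\<lambda>_. Suc ?k) (pending qs0) qs d"
        and T: "T1 + 20 * int n + 20 * int m + 1 - 1 \<le> T"
      show "wp W (WhileLess 11 12 drain_body) (peel_inv f t x T0) (R, mem d f q t x) T"
      proof (rule wp_drain[OF _ T1 lists])
        show "drain_inv f t x (Suc ?k) T1 (R, mem d f q t x) T"
          by (rule drain_inv.intros[OF R(1,2) _ _ R(5) qs(3)])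
            (use R qs T pend[of qs0] in simp_all)
        fix R q d qs T
        assume R: "base R" "R 9 = Suc ?k" "R 10 = Suc ?k - 1" "R 11 = length qs" "R 12 = length qs"
          and q: "holds_queue q qs" and p: "peeling (\<lambda>_. Suc ?k) (pending qs) qs d"
          and T: "T1 - 1 \<le> T"
        show "peel_inv f t x T0 (R, mem d f q t x) T"
          by (rule peel_inv.intros[OF R(1) _ _ R(4,5) q])
            (use R p T stuck(1) lower in \<open>simp_all add: T1_def\<close>)
      qed
    qed
    moreover have "?k \<le> W" "Suc ?k \<le> W" using stuck(1) word_bounds(4) by linarith+
    ultimately show ?thesis
      by (simp add: peel_body_def wp_simps 1(1,2,5,6) b)
  qed
qed

section \<open>Handing colors back along ingoing arcs\<close>

inductive mark_inv :: "(nat \<Rightarrow> nat) \<Rightarrow> (nat \<Rightarrow> nat) \<Rightarrow> (nat \<Rightarrow> nat) \<Rightarrow> (nat \<Rightarrow> nat) \<Rightarrow> (nat \<Rightarrow> nat) \<Rightarrow>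
    nat \<Rightarrow> nat \<Rightarrow> nat \<Rightarrow> nat \<Rightarrow> int \<Rightarrow> state \<Rightarrow> int \<Rightarrow> bool"
  for d f q t x k i w a T0 where
  "base R \<Longrightarrow> R 9 = k \<Longrightarrow> R 10 = k - 1 \<Longrightarrow> R 16 = a \<Longrightarrow> R 18 = i \<Longrightarrow>
   chain x (R 13) l \<Longrightarrow> distinct l \<Longrightarrow> set l \<subseteq> {e \<in> {1..m}. dst e = w} \<Longrightarrow>
   t' = (\<lambda>u. if u \<in> src ` ({e \<in> {1..m}. dst e = w} - set l) then a else t u) \<Longrightarrow>
   10 * int (length l) + T0 \<le> T \<Longrightarrow>
   mark_inv d f q t x k i w a T0 (R, mem d f q t' x) T"

lemma wp_mark:
  assumes "mark_inv d f q t x k i w a T0 s T" "1 \<le> T0"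
    and exit: "\<And>R T. base R \<Longrightarrow> R 9 = k \<Longrightarrow> R 10 = k - 1 \<Longrightarrow> R 18 = i \<Longrightarrow> T0 - 1 \<le> T \<Longrightarrow>
      Q (R, mem d f q (\<lambda>u. if u \<in> src ` {e \<in> {1..m}. dst e = w} then a else t u) x) T"
  shows "wp W (WhileLess 0 13 mark_body) Q s T"
  using assms(1)
proof (rule wp_While)
  show "0 \<le> T'" if "mark_inv d f q t x k i w a T0 s' T'" for s' T'
    using that assms(2) by cases simp
  show "Q (R, M) (T' - 1)" if "mark_inv d f q t x k i w a T0 (R, M) T'" "\<not> R 0 < R 13" for R M T'
    using that(1)
  proof cases
    case (1 l t')
    then have "R 13 = 0" using that(2) baseD(1)[OF 1(2)] by simp
    then have "l = []" using 1(7) by simp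
    then have "T0 - 1 \<le> T' - 1"
      and t': "t' = (\<lambda>u. if u \<in> src ` {e \<in> {1..m}. dst e = w} then a else t u)"
      using 1(10,11) by simp_all
    then show ?thesis using exit[OF 1(2-4) 1(6)] by (simp add: 1(1))
  qed
  show "wp W mark_body (mark_inv d f q t x k i w a T0) (R, M) (T' - 1)"
    if "mark_inv d f q t x k i w a T0 (R, M) T'" "R 0 < R 13" for R M T'
    using that(1)
  proof cases
    case (1 l t')
    note b = baseD[OF 1(2)]
    let ?e = "R 13" and ?I = "{e \<in> {1..m}. dst e = w}"
    have "0 < ?e" using that(2) b by simp
    then obtain l' where l: "l = ?e # l'" "chain x (x ?e) l'"
      using chain_pos[OF 1(7)] by auto
    have eI: "?e \<in> ?I" using 1(9) l(1) by auto
    then have e: "?e \<noteq> 0" "?e \<le> m" "1 \<le> ?e" by auto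
    note ends = ends_less[OF e(3,2)]
    have "?I - set l' = insert ?e (?I - set l)" using eI l(1) 1(8) by auto
    then have im: "src ` (?I - set l') = insert (src ?e) (src ` (?I - set l))"
      by (simp only: image_insert)
    have t'': "t'(src ?e := a) = (\<lambda>u. if u \<in> src ` (?I - set l') then a else t u)"
      unfolding 1(10) im by (rule ext, simp only: fun_upd_apply insert_iff split: if_split) blast
    have step: "mark_inv d f q t x k i w a T0 (R', mem d f q (t'(src ?e := a)) x) T''"
      if R': "base R'" "R' 9 = k" "R' 10 = k - 1" "R' 16 = a" "R' 18 = i" "R' 13 = x ?e"
        and T'': "T' \<le> T'' + 10" for R' T''
    proof (rule mark_inv.intros[OF R'(1-5) _ _ _ t''])
      show "chain x (R' 13) l'" using l(2) R'(6) by simp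
      show "distinct l'" "set l' \<subseteq> ?I" using 1(8,9) l(1) by auto
      show "10 * int (length l') + T0 \<le> T''" using 1(11) T'' l(1) by simp
    qed
    note r = 1(1-6) b e ends
    show ?thesis
      by (simp add: mark_body_def wp_simps r, rule step) (simp_all add: r)
  qed
qed

text \<open>The queue is read backwards, so here \<open>pending\<close> is applied to a suffix: its
  arcs are those whose heads are not colored yet.\<close>

inductive color_inv :: "(nat \<Rightarrow> nat) \<Rightarrow> (nat \<Rightarrow> nat) \<Rightarrow> (nat \<Rightarrow> nat) \<Rightarrow> nat \<Rightarrow> nat list \<Rightarrow> int \<Rightarrow> state \<Rightarrow> int \<Rightarrow> bool"
  for f q x k qs T0 where
  "base R \<Longrightarrow> R 9 = k \<Longrightarrow> R 10 = k - 1 \<Longrightarrow> R 18 \<le> length qs \<Longrightarrow> color_ok k qs (R 18) d t \<Longrightarrow>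
   20 * int (R 18) + 10 * int (card (pending (drop (R 18) qs))) + T0 \<le> T \<Longrightarrow>
   color_inv f q x k qs T0 (R, mem d f q t x) T"

text \<open>The array of counters now receives the colors. The removal order is therefore remembered
  as a fact about \<open>A\<close> and \<open>d0\<close> that is detached from memory.\<close>

lemma wp_color:
  assumes "color_inv f q x k qs T0 s T" "1 \<le> T0" and lists: "in_lists m f x"
    and q: "holds_queue q qs" "length qs = n" and p: "peeling (\<lambda>_. k) A qs d0" and k: "k \<le> 2"
    and exit: "\<And>R d t T. base R \<Longrightarrow> R 9 = k \<Longrightarrow> color_ok k qs 0 d t \<Longrightarrow> T0 - 1 \<le> T \<Longrightarrow>
      Q (R, mem d f q t x) T"
  shows "wp W (WhileLess 0 18 color_body) Q s T"
  using assms(1)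
proof (rule wp_While)
  show "0 \<le> T'" if "color_inv f q x k qs T0 s' T'" for s' T'
    using that assms(2) by cases simp
  show "Q (R, M) (T' - 1)" if "color_inv f q x k qs T0 (R, M) T'" "\<not> R 0 < R 18" for R M T'
    using that(1)
  proof cases
    case (1 d t)
    then have "R 18 = 0" using that(2) baseD(1)[OF 1(2)] by simp
    then show ?thesis using 1 exit[of R d t "T' - 1"] by simp
  qed
  show "wp W color_body (color_inv f q x k qs T0) (R, M) (T' - 1)"
    if "color_inv f q x k qs T0 (R, M) T'" "R 0 < R 18" for R M T'
    using that(1)
  proof cases
    case (1 d t)
    note b = baseD[OF 1(2)]
    have "0 < R 18" using that(2) b by simp
    then obtain i where i: "R 18 = Suc i" by (metis gr0_implies_Suc)
    then have il: "i < length qs" "i < n" using 1(5) q(2) by auto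
    let ?w = "qs ! i"
    have qi: "q i = ?w" using q(1) il by (simp add: holds_queue_def)
    have w: "?w < n" using p nth_mem[OF il(1)] by (auto simp: peeling_def)
    let ?l = "in_list m ?w"
    have l: "chain x (f ?w) ?l" using lists w by simp
    have drop_i: "drop i qs = ?w # drop (Suc i) qs" using il by (simp add: Cons_nth_drop_Suc)
    have "distinct (drop i qs)" using p by (simp add: peeling_def)
    then have wn: "?w \<notin> set (drop (Suc i) qs)" using drop_i by simp
    have "pending (drop (Suc i) qs) = pending (drop i qs) \<union> set ?l"
      "pending (drop i qs) \<inter> set ?l = {}"
      using wn by (auto simp: into_def set_in_list drop_i)
    then have "card (pending (drop (Suc i) qs)) = card (pending (drop i qs)) + card (set ?l)"
      by (simp add: card_Un_disjoint)
    then have card: "card (pending (drop (Suc i) qs)) = card (pending (drop i qs)) + length ?l"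
      by (simp add: distinct_in_list distinct_card)
    have ok: "color_ok k qs i (d(?w := t ?w))
        (\<lambda>u. if u \<in> src ` {e \<in> {1..m}. dst e = ?w} then k - 1 - t ?w else t u)"
      using color_ok_step[OF _ il(1) p k] 1(6) i by simp
    have inner: "wp W (WhileLess 0 13 mark_body) (color_inv f q x k qs T0)
        (R', mem (d(?w := t ?w)) f q t x) (T' - 11)"
      if R': "base R'" "R' 9 = k" "R' 10 = k - 1" "R' 16 = k - 1 - t ?w" "R' 18 = i"
        "R' 13 = f ?w" for R'
    proof (rule wp_mark)
      show "mark_inv (d(?w := t ?w)) f q t x k i ?w (k - 1 - t ?w)
          (20 * int i + 10 * int (card (pending (drop i qs))) + T0 + 1)
          (R', mem (d(?w := t ?w)) f q t x) (T' - 11)"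
      proof (rule mark_inv.intros[OF R'(1-5) _ distinct_in_list[of m ?w]])
        show "chain x (R' 13) ?l" using l R'(6) by simp
        show "set ?l \<subseteq> {e \<in> {1..m}. dst e = ?w}" by (simp add: set_in_list)
        show "t = (\<lambda>u. if u \<in> src ` ({e \<in> {1..m}. dst e = ?w} - set ?l) then k - 1 - t ?w else t u)"
          by (simp add: set_in_list)
        show "10 * int (length ?l) + (20 * int i + 10 * int (card (pending (drop i qs))) + T0 + 1) \<le> T' - 11"
          using 1(7) card i by simp
      qed
      show "1 \<le> 20 * int i + 10 * int (card (pending (drop i qs))) + T0 + 1" using assms(2) by simp
      fix R T
      assume R: "base R" "R 9 = k" "R 10 = k - 1" "R 18 = i"
        and T: "20 * int i + 10 * int (card (pending (drop i qs))) + T0 + 1 - 1 \<le> T"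
      show "color_inv f q x k qs T0 (R, mem (d(?w := t ?w)) f q
          (\<lambda>u. if u \<in> src ` {e \<in> {1..m}. dst e = ?w} then k - 1 - t ?w else t u) x) T"
        by (rule color_inv.intros[OF R(1-3)]) (use R(4) il T ok in simp_all)
    qed
    show ?thesis
      by (simp add: color_body_def wp_simps 1(1-4) b i il qi w, rule inner) (simp_all add: 1(2-4))
  qed
qed

text \<open>The output overwrites cells of \<open>d\<close>, but only those that have already been read.\<close>

inductive output_inv :: "nat \<Rightarrow> (nat \<Rightarrow> nat) \<Rightarrow> int \<Rightarrow> state \<Rightarrow> int \<Rightarrow> bool" for k c T0 where
  "base R \<Longrightarrow> R 13 \<le> n \<Longrightarrow> M 0 = k \<Longrightarrow> (\<And>v. v < R 13 \<Longrightarrow> M (Suc v) = Suc (c v)) \<Longrightarrow>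
   (\<And>v. R 13 \<le> v \<Longrightarrow> v < n \<Longrightarrow> M (bd + v) = c v) \<Longrightarrow>
   10 * (int n - int (R 13)) + T0 \<le> T \<Longrightarrow> output_inv k c T0 (R, M) T"

lemma wp_output:
  assumes "output_inv k c T0 s T" "1 \<le> T0" and c: "\<And>v. v < n \<Longrightarrow> c v \<le> 1"
    and exit: "\<And>R M T. M 0 = k \<Longrightarrow> (\<And>v. v < n \<Longrightarrow> M (Suc v) = Suc (c v)) \<Longrightarrow> T0 - 1 \<le> T \<Longrightarrow> Q (R, M) T"
  shows "wp W (WhileLess 13 2 output_body) Q s T"
  using assms(1)
proof (rule wp_While)
  show "0 \<le> T'" if "output_inv k c T0 s' T'" for s' T'
    using that assms(2) by cases simp
  show "Q (R, M) (T' - 1)" if "output_inv k c T0 (R, M) T'" "\<not> R 13 < R 2" for R M T'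
    using that(1)
  proof cases
    case 1
    then have "R 13 = n" using that(2) baseD(4)[OF 1(1)] by simp
    then show ?thesis using 1 exit[of M "T' - 1" R] by simp
  qed
  show "wp W output_body (output_inv k c T0) (R, M) (T' - 1)"
    if "output_inv k c T0 (R, M) T'" "R 13 < R 2" for R M T'
    using that(1)
  proof cases
    case 1
    note b = baseD[OF 1(1)]
    let ?v = "R 13"
    have v: "?v < n" using that(2) b by simp
    have read: "M (bd + ?v) = c ?v" using 1(5) v by simp
    have cW: "Suc (c ?v) \<le> W" using c[OF v] word_bounds(4) by linarith
    have step: "output_inv k c T0 (R', M(Suc ?v := Suc (c ?v))) T''"
      if R': "base R'" "R' 13 = Suc ?v" and T'': "T' \<le> T'' + 10" for R' T''
    proof (rule output_inv.intros[OF R'(1)])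
      show "R' 13 \<le> n" using R'(2) v by simp
      show "(M(Suc ?v := Suc (c ?v))) 0 = k" using 1(3) by simp
      show "(M(Suc ?v := Suc (c ?v))) (Suc u) = Suc (c u)" if "u < R' 13" for u
        using that R'(2) 1(4) by (auto simp: less_Suc_eq)
      show "(M(Suc ?v := Suc (c ?v))) (bd + u) = c u" if "R' 13 \<le> u" "u < n" for u
        using that R'(2) 1(5)[of u] by (simp add: bd_def)
      show "10 * (int n - int (R' 13)) + T0 \<le> T''" using 1(6) T'' R'(2) by simp
    qed
    show ?thesis
      by (simp add: output_body_def wp_simps b v read cW 1(1), rule step) (simp_all add: 1(1))
  qed
qed

section \<open>The whole program and its running time\<close>

lemma wp_coloring_prog:
  "wp W coloring_prog
     (\<lambda>(R, M) T. 0 \<le> T \<and> M 0 = dichromatic_number (with_proj G) \<and>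
        optimal_acyclic_coloring (with_proj G) (\<lambda>v. M (1 + v)))
     (initial_state (encode n es)) (200 * (int n + int m + 1))"
proof -
  define Q :: "state \<Rightarrow> int \<Rightarrow> bool" where
    "Q = (\<lambda>(R, M) T. 0 \<le> T \<and> M 0 = dichromatic_number (with_proj G) \<and>
       optimal_acyclic_coloring (with_proj G) (\<lambda>v. M (1 + v)))"
  \<comment> \<open>Credits are fixed backwards: \<open>T1\<close> for the output, \<open>T2\<close>
    from the coloring on, \<open>T3\<close> from the removal on. With \<open>20 * m\<close> for the
    lists and 10 for the setup this makes \<open>90 * n + 70 * m + 60\<close>, well below the credit
    provided.\<close>
  define T1 where "T1 = 10 * int n + 10"
  define T2 where "T2 = T1 + 20 * int n + 10 * int m + 10"
  define T3 where "T3 = T2 + 2 * (30 * int n + 20 * int m + 10) + 10"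
  let ?z = "\<lambda>_. 0 :: nat"
  have T: "1 \<le> T1" "1 \<le> T2" "1 \<le> T3" by (simp_all add: T1_def T2_def T3_def)
  have pend: "card (pending qs) \<le> m" for qs
    using card_mono[of "{1..m}" "pending qs"] by auto
  have output_phase: "wp W (WhileLess 13 2 output_body) Q (R, (mem d f q t x)(0 := k)) T"
    if R: "base R" "R 13 = 0" and ok: "color_ok k qs 0 d t" and qs: "length qs = n"
      and p: "peeling (\<lambda>_. k) A qs d0" and k: "k \<le> 2"
      and lower: "\<And>r c. r < k \<Longrightarrow> \<not> acyclic_coloring (with_proj G) r c" and T: "T1 \<le> T"
    for R d f q t x k qs A d0 T
  proof (rule wp_output)
    have set: "set qs = {..<n}" using peeling_length(3)[OF p qs] .
    have d: "complements_later k qs 0 d" "\<And>u. u < n \<Longrightarrow> d u \<le> k - 1"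
      using ok set by (auto simp: color_ok_def)
    \<comment> \<open>Threshold 0 admits no vertex to the queue, yet the queue contains all of them;
      so \<open>k = 0\<close> is the case of the empty digraph.\<close>
    have k1: "n = 0 \<or> 1 \<le> k"
    proof (rule ccontr)
      assume "\<not> (n = 0 \<or> 1 \<le> k)"
      then have "0 < n" "k = 0" by auto
      then show False using p set by (auto simp: peeling_def)
    qed
    note col = acyclic_coloring_of_peeling[OF p qs k k1 d]
    show "output_inv k d 5 (R, (mem d f q t x)(0 := k)) T"
      by (rule output_inv.intros[OF R(1)]) (use R(2) T in \<open>simp_all add: T1_def, simp add: bd_def\<close>)
    show "d v \<le> 1" if "v < n" for v using d(2)[OF that] k by simp
    fix R M T assume M: "M 0 = k" "\<And>v. v < n \<Longrightarrow> M (Suc v) = Suc (d v)" and T: "(5::int) - 1 \<le> T"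
    \<comment> \<open>Only the values at vertices matter, so the contents of the cells behind the
      output are irrelevant.\<close>
    have "acyclic_coloring (with_proj G) k (\<lambda>v. M (1 + v))"
    proof -
      have "(\<lambda>v. M (1 + v)) ` pverts G = (\<lambda>v. Suc (d v)) ` pverts G"
        using M(2) by (auto simp: verts image_iff)
      moreover have "{v \<in> pverts G. M (1 + v) = i} = {v \<in> pverts G. Suc (d v) = i}" for i
        using M(2) by (auto simp: verts)
      ultimately show ?thesis using col by (simp add: acyclic_coloring_def)
    qed
    moreover have "dichromatic_number (with_proj G) = k"
      using dichromatic_number_eqI[OF col lower] .
    ultimately show "Q (R, M) T" using M T by (simp add: Q_def optimal_acyclic_coloring_def)
  qed simp
  have color: "wp W (WhileLess 0 18 color_body)
      (wp W (Store 0 9 ;; Const 13 0 ;; WhileLess 13 2 output_body) Q) (R, mem d f q ?z x) T"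
    if R: "base R" "R 9 = k" "R 10 = k - 1" "R 18 = n" and lists: "in_lists m f x"
      and qs: "length qs = n"
      and q: "holds_queue q qs" and p: "peeling (\<lambda>_. k) A qs d" and k: "k \<le> 2"
      and lower: "\<And>r c. r < k \<Longrightarrow> \<not> acyclic_coloring (with_proj G) r c" and T: "T2 - 2 \<le> T"
    for R d f q x k qs A T
  proof (rule wp_color[OF _ _ lists q qs p k])
    \<comment> \<open>Nothing is colored yet. The zeros of the untouched array \<open>t\<close> are
      the default color of vertices without an arc to a later position.\<close>
    have "color_ok k qs n d ?z" using qs by (simp add: color_ok_def complements_later_def)
    then show "color_inv f q x k qs (T1 + 5) (R, mem d f q ?z x) T"
      by (intro color_inv.intros[OF R(1-3)]) (use R(4) qs T pend[of "[]"] in \<open>simp_all add: T2_def\<close>)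
    show "1 \<le> T1 + 5" using \<open>1 \<le> T1\<close> by simp
    fix R d t T assume R: "base R" "R 9 = k" and ok: "color_ok k qs 0 d t" and T: "T1 + 5 - 1 \<le> T"
    show "wp W (Store 0 9 ;; Const 13 0 ;; WhileLess 13 2 output_body) Q (R, mem d f q t x) T"
      by (simp add: wp_simps R(2) baseD[OF R(1)], rule output_phase[OF _ _ ok qs p k lower])
        (use R(1) T in simp_all)
  qed
  have peel: "wp W (WhileLess 12 2 peel_body)
      (wp W (Add 18 12 0 ;; WhileLess 0 18 color_body ;; Store 0 9 ;; Const 13 0 ;;
         WhileLess 13 2 output_body) Q) (R, mem (degree m) f ?z ?z x) T"
    if R: "base R" "R 9 = 0" "R 10 = 0" "R 11 = 0" "R 12 = 0" and lists: "in_lists m f x"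
      and T: "T3 - 1 \<le> T"
    for R f x T
  proof (rule wp_peel[OF _ \<open>1 \<le> T2\<close> lists])
    have "peeling (\<lambda>_. 0) (pending []) [] (degree m)"
      using peeling_0 by (simp add: degree_def[abs_def] into_def)
    then show "peel_inv f ?z x T2 (R, mem (degree m) f ?z ?z x) T"
      by (intro peel_inv.intros[where qs = "[]"])
        (use R T in \<open>simp_all add: T3_def holds_queue_def\<close>)
    fix R q d qs T
    assume R: "base R" "R 9 \<le> 2" "R 10 = R 9 - 1" "R 12 = n" and qs: "length qs = n"
      "holds_queue q qs"
        "peeling (\<lambda>_. R 9) (pending qs) qs d"
      and lower: "\<And>r c. r < R 9 \<Longrightarrow> \<not> acyclic_coloring (with_proj G) r c" and T: "T2 - 1 \<le> T"
    show "wp W (Add 18 12 0 ;; WhileLess 0 18 color_body ;; Store 0 9 ;; Const 13 0 ;;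
        WhileLess 13 2 output_body) Q (R, mem d f q ?z x) T"
      by (subst wp_Seq, subst wp_Add, subst wp_Seq, intro conjI,
          use R(4) baseD[OF R(1)] in simp, rule color[OF _ _ _ _ lists qs(1,2,3) R(2) lower])
        (use R T baseD[OF R(1)] in simp_all)
  qed
  have build: "wp W (WhileLess 13 3 build_body)
      (wp W (WhileLess 12 2 peel_body ;; Add 18 12 0 ;; WhileLess 0 18 color_body ;; Store 0 9 ;;
         Const 13 0 ;; WhileLess 13 2 output_body) Q) (R, mem ?z ?z ?z ?z ?z) T"
    if R: "base R" "R 9 = 0" "R 10 = 0" "R 11 = 0" "R 12 = 0" "R 13 = 0"
      and T: "T3 + 20 * int m \<le> T" for R T
  proof (rule wp_build[OF _ \<open>1 \<le> T3\<close>])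
    have "mem ?z ?z ?z ?z ?z = mem (degree (R 13)) ?z ?z ?z ?z" using R(6) by (simp add: degree_0)
    moreover have "build_inv T3 (R, mem (degree (R 13)) ?z ?z ?z ?z) T"
      by (rule build_inv.intros) (use R T in \<open>simp_all add: in_list_def\<close>)
    ultimately show "build_inv T3 (R, mem ?z ?z ?z ?z ?z) T" by simp
  qed (subst wp_Seq, rule peel, assumption+)
  have "mem ?z ?z ?z ?z ?z 0 = n" "mem ?z ?z ?z ?z ?z (Suc 0) = m" by (simp_all add: mem_def)
  moreover have "m + m \<le> W" "m + m + 1 \<le> W" "m + m + 1 + 1 \<le> W" "bd \<le> W" "bd + n \<le> W"
    "bd + n + n \<le> W"
      "bd + n + n + n \<le> W" "bd + n + n + n + n \<le> W"
    using W by (simp_all add: bd_def)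
  ultimately show ?thesis
    unfolding coloring_prog_def setup_prog_def initial_state_encode Q_def[symmetric]
    by (simp add: wp_simps, intro conjI build)
      (simp_all add: base_def base_defs T1_def T2_def T3_def)
qed

end

theorem theorem3p14:
  shows "\<exists>(P :: com) (C :: nat) (D :: nat).
    \<forall>(G :: nat pair_pre_digraph) (n :: nat) (es :: (nat \<times> nat) list).
      directed_cactus_forest (with_proj G) \<and> pverts G = {0..<n} \<and> arc_list_of G es \<longrightarrow>
      (\<exists>t R M. exec (D * (n + card (parcs G) + 1)) P (initial_state (encode n es)) t (R, M) \<and>
         t \<le> C * (n + card (parcs G) + 1) \<and>
         M 0 = dichromatic_number (with_proj G) \<and>
         optimal_acyclic_coloring (with_proj G) (\<lambda>v. M (1 + v)))"
proof (rule exI[of _ coloring_prog], rule exI[of _ 200], rule exI[of _ 4], intro allI impI)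
  fix G :: "nat pair_pre_digraph" and n :: nat and es :: "(nat \<times> nat) list"
  assume G: "directed_cactus_forest (with_proj G) \<and> pverts G = {0..<n} \<and> arc_list_of G es"
  interpret arc_list n es G using G by unfold_locales auto
  interpret arc_list_ram n es G "4 * (n + card (parcs G) + 1)"
    by unfold_locales (simp add: card_arcs)
  obtain t R M where "exec (4 * (n + card (parcs G) + 1)) coloring_prog (initial_state (encode n es)) t (R, M)"
    "0 \<le> 200 * (int n + int m + 1) - int t"
    "M 0 = dichromatic_number (with_proj G)"
     "optimal_acyclic_coloring (with_proj G) (\<lambda>v. M (1 + v))"
    using wp_coloring_prog unfolding wp_def by auto
  moreover from this(2) have "int t \<le> int (200 * (n + card (parcs G) + 1))"
    by (simp add: card_arcs)
  ultimately show "\<exists>t R M. exec (4 * (n + card (parcs G) + 1)) coloring_prog (initial_state (encode n es)) t (R, M) \<and>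
      t \<le> 200 * (n + card (parcs G) + 1) \<and> M 0 = dichromatic_number (with_proj G) \<and>
      optimal_acyclic_coloring (with_proj G) (\<lambda>v. M (1 + v))"
    unfolding of_nat_le_iff by blast
qed

end
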